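(* Let $\lambda$ be a partition with $d=\ell(\lambda)$ parts and $\mu$ a partition with $[\mu]\subseteq[\lambda]$. Then $$f^{\lambda/\mu}=\frac{|\lambda/\mu|!}{\prod_{u\in[\lambda]}h(u)}\sum_{D\in\mathcal{RE}(\lambda/\mu)}\ \prod_{(i,j)\in B(D)}(\lambda_i+d-j),$$ where $\mathcal{RE}(\lambda/\mu)$ is the set of reverse excited diagrams of $\lambda/\mu$ and $B(D)$ is the set of cells of the broken diagonals of $D$. (The quantity $\lambda_i+d-j$ is the arm length of the cell $(i,j)$, i.e. the number of cells of row $i$ of the shifted diagram $[\lambda^*]$ lying in columns $\ge j$.)
   Context: Diagrams use matrix coordinates $(i,j)$ (row, column). $f^{\lambda/\mu}$ is the number of standard Young tableaux of shape $\lambda/\mu$; $h(i,j)=\lambda_i+\lambda'_j-i-j+1$ is the hook length; $\mu_i=0$ for $i>\ell(\mu)$; $\mu'$ is the conjugate of $\mu$; the content of a cell $(i,j)$ is $j-i$. Shifted diagrams: $[\lambda^*]=\{(i,j):1\le i\le d,\ i\le j\le \lambda_i+d-1\}$, $[\mu^*]=\{(i,j):1\le i\le d,\ i\le j\le\mu_i+d-1\}$, and $[\lambda^*/\mu^*]=[\lambda^*]\setminus[\mu^*]$ (so the cell $(i,j)$ of $[\lambda/\mu]$ corresponds to $(i,j+d-1)$). Reverse excited move: for $D\subseteq[\lambda^*]$ and $(i,j)\in D$ with $(i-1,j-1),(i-1,j)\in[\lambda^*]$ and none of $(i-1,j-1),(i-1,j),(i,j-1)$ in $D$ (the cell $(i,j-1)$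 may lie outside $[\lambda^*]$), replace $(i,j)$ by $(i-1,j-1)$. $\mathcal{RE}(\lambda/\mu)$ is the set of all diagrams obtained from $[\lambda^*/\mu^*]$ by any (possibly empty) sequence of reverse excited moves. Broken diagonals: to each $D\in\mathcal{RE}(\lambda/\mu)$ one associates $\mathsf d_1(D),\dots,\mathsf d_{\mu_1}(D)\subseteq[\lambda^*]\setminus D$. For $D=[\lambda^*/\mu^*]$, $\mathsf d_r$ is the set of cells of $[\mu^*]$ with content $r-\mu'_r+d-1$. If $D'$ is obtained from $D$ by the reverse excited move $(i,j)\to(i-1,j-1)$, then $\mathsf d_r(D')=\mathsf d_r(D)$ for $r\ne t$ and $\mathsf d_t(D')=(\mathsf d_t(D)\setminus\{(i-1,j)\})\cup\{(i,j)\}$, where $t$ is the unique index with $(i-1,j)\in\mathsf d_t(D)$. This is well defined (independent of the sequence of moves). $B(D)=\bigcup_r\mathsf d_r(D)$. *)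

theory Defs
  imports Complex_Main "HOL-Library.FuncSet"
begin

(* Partitions are weakly decreasing lists of positive integers, so the length of the list is the
   number of parts.  Cells are pairs (row, column), both counted from 1. *)

type_synonym cell = "nat \<times> nat"

definition is_partition :: "nat list \<Rightarrow> bool" where
  "is_partition lam \<longleftrightarrow> sorted_wrt (\<ge>) lam \<and> 0 \<notin> set lam"

definition part :: "nat list \<Rightarrow> nat \<Rightarrow> nat" where
  "part lam i = (if 1 \<le> i \<and> i \<le> length lam then lam ! (i - 1) else 0)"

definition conj_part :: "nat list \<Rightarrow> nat \<Rightarrow> nat" where
  "conj_part lam j = card {i. 1 \<le> i \<and> i \<le> length lam \<and> j \<le> part lam i}"

definition diagram :: "nat list \<Rightarrow> cell set" where
  "diagram lam = {(i, j). 1 \<le> i \<and> i \<le> length lam \<and> 1 \<le> j \<and> j \<le> part lam i}"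

definition skew_diagram :: "nat list \<Rightarrow> nat list \<Rightarrow> cell set" where
  "skew_diagram lam mu = diagram lam - diagram mu"

definition hook :: "nat list \<Rightarrow> cell \<Rightarrow> int" where
  "hook lam = (\<lambda>(i, j). int (part lam i) + int (conj_part lam j) - int i - int j + 1)"

definition content :: "cell \<Rightarrow> int" where
  "content = (\<lambda>(i, j). int j - int i)"

(* Fillings are taken undefined outside S (extensional), so that they are counted once each. *)
definition standard_tableaux :: "cell set \<Rightarrow> (cell \<Rightarrow> nat) set" where
  "standard_tableaux S = {T \<in> extensional S. bij_betw T S {1..card S} \<and>
     (\<forall>i j j'. (i, j) \<in> S \<longrightarrow> (i, j') \<in> S \<longrightarrow> j < j' \<longrightarrow> T (i, j) < T (i, j')) \<and>
     (\<forall>i i' j. (i, j) \<in> S \<longrightarrow> (i', j) \<in> S \<longrightarrow> i < i' \<longrightarrow> T (i, j) < T (i', j))}"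

definition num_SYT :: "nat list \<Rightarrow> nat list \<Rightarrow> nat" where
  "num_SYT lam mu = card (standard_tableaux (skew_diagram lam mu))"

(* The shifted diagram of nu with d rows, where d is always the number of parts of the outer
   partition: rows with part nu i = 0 still have cells.  The bound j \<le> part nu i + d - 1 is
   written with a strict inequality to avoid truncated subtraction. *)
definition shifted_diagram :: "nat \<Rightarrow> nat list \<Rightarrow> cell set" where
  "shifted_diagram d nu = {(i, j). 1 \<le> i \<and> i \<le> d \<and> i \<le> j \<and> j < part nu i + d}"

definition shifted_skew :: "nat list \<Rightarrow> nat list \<Rightarrow> cell set" where
  "shifted_skew lam mu =
     shifted_diagram (length lam) lam - shifted_diagram (length lam) mu"

(* The truncated i - 1 and j - 1 are harmless: rows of the shifted diagram start at 1, so
   membership of the cell (i - 1, j - 1) forces i and j to be at least 2. *)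
definition reverse_excited_move ::
    "nat list \<Rightarrow> nat \<Rightarrow> nat \<Rightarrow> cell set \<Rightarrow> cell set \<Rightarrow> bool" where
  "reverse_excited_move lam i j D D' \<longleftrightarrow>
     D \<subseteq> shifted_diagram (length lam) lam \<and> (i, j) \<in> D \<and>
     (i - 1, j - 1) \<in> shifted_diagram (length lam) lam \<and>
     (i - 1, j) \<in> shifted_diagram (length lam) lam \<and>
     (i - 1, j - 1) \<notin> D \<and> (i - 1, j) \<notin> D \<and> (i, j - 1) \<notin> D \<and>
     D' = (D - {(i, j)}) \<union> {(i - 1, j - 1)}"

inductive_set reverse_excited_diagrams :: "nat list \<Rightarrow> nat list \<Rightarrow> cell set set"
  for lam mu :: "nat list" where
  start: "shifted_skew lam mu \<in> reverse_excited_diagrams lam mu"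
| move: "D \<in> reverse_excited_diagrams lam mu \<Longrightarrow> reverse_excited_move lam i j D D' \<Longrightarrow>
     D' \<in> reverse_excited_diagrams lam mu"

(* Empty for indices r outside {1..part mu 1}. *)
definition initial_broken_diagonals :: "nat list \<Rightarrow> nat list \<Rightarrow> nat \<Rightarrow> cell set" where
  "initial_broken_diagonals lam mu r =
     (if 1 \<le> r \<and> r \<le> part mu 1
      then {u \<in> shifted_diagram (length lam) mu.
              content u = int r - int (conj_part mu r) + int (length lam) - 1}
      else {})"

(* broken_diagonals_rel lam mu D b: some sequence of reverse excited moves from the initial
   diagram leads to D and transforms the initial family of broken diagonals into b. *)
inductive broken_diagonals_rel ::
    "nat list \<Rightarrow> nat list \<Rightarrow> cell set \<Rightarrow> (nat \<Rightarrow> cell set) \<Rightarrow> bool"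
  for lam mu :: "nat list" where
  start: "broken_diagonals_rel lam mu (shifted_skew lam mu) (initial_broken_diagonals lam mu)"
| move: "broken_diagonals_rel lam mu D b \<Longrightarrow> reverse_excited_move lam i j D D' \<Longrightarrow>
     t \<in> {1..part mu 1} \<Longrightarrow> (i - 1, j) \<in> b t \<Longrightarrow>
     broken_diagonals_rel lam mu D' (b(t := (b t - {(i - 1, j)}) \<union> {(i, j)}))"

(* Independence of the sequence of moves is not built in: the description below denotes the
   intended family because the relation is functional on the reverse excited diagrams. *)
definition broken_diagonals :: "nat list \<Rightarrow> nat list \<Rightarrow> cell set \<Rightarrow> nat \<Rightarrow> cell set" where
  "broken_diagonals lam mu D = (THE b. broken_diagonals_rel lam mu D b)"

definition broken_cells :: "nat list \<Rightarrow> nat list \<Rightarrow> cell set \<Rightarrow> cell set" where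
  "broken_cells lam mu D = (\<Union>r\<in>{1..part mu 1}. broken_diagonals lam mu D r)"

end

theory Submission
  imports Defs
begin

text \<open>
  Write \<open>s\<^sup>*\<^bsub>m\<^esub>(\<lambda>)\<close> for the shifted Schur function: the sum over reverse tableaux \<open>T\<close> of shape \<open>m\<close> of the product
  of \<open>\<lambda>\<^bsub>T(u)\<^esub> - c(u)\<close>.  The theorem splits into two independent statements.

  The first is \<open>f\<^bsup>\<lambda>/\<mu>\<^esup> \<cdot> H = |\<lambda>/\<mu>|! \<cdot> s\<^sup>*\<^bsub>\<mu>\<^esub>(\<lambda>)\<close>, where \<open>H\<close> is the product of the hook lengths of \<open>\<lambda>\<close>
  (\<open>card_standard_tableaux_shifted_schur\<close>).  Removing the entry 1 from a standard tableau shows that \<open>f\<^bsup>\<lambda>/\<mu>\<^esup>\<close> is the sum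
  of \<open>f\<^bsup>\<lambda>/\<nu>\<^esup>\<close> over the \<open>\<nu> \<subseteq> \<lambda>\<close> with one more box than \<open>\<mu>\<close>.  The right side satisfies the same recursion by
  the Pieri rule \<open>(|\<lambda>| - |\<mu>|) s\<^sup>*\<^bsub>\<mu>\<^esub>(\<lambda>) = \<Sum> s\<^sup>*\<^bsub>\<nu>\<^esub>(\<lambda>)\<close> (\<open>shifted_schur_pieri\<close>), in which the terms with \<open>\<nu>\<close> not
  contained in \<open>\<lambda>\<close> vanish (\<open>shifted_schur_eq_0_if_not_contained\<close>).  The recursion stops at \<open>\<mu> = \<lambda>\<close>, where
  \<open>s\<^sup>*\<^bsub>\<lambda>\<^esub>(\<lambda>) = H\<close> (\<open>shifted_schur_self\<close>).  The Pieri rule itself is proved by induction on the number of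
  variables from the branching rule, where it reduces to a telescoping identity between weights of
  horizontal strips.

  The second is a bijection between reverse excited diagrams and the reverse tableaux of shape \<open>\<mu>\<close> with
  nonzero product.  Tableaux are encoded as Gelfand--Tsetlin patterns \<open>\<nu>\<close>, row \<open>\<nu> a\<close> being the shape of the entries
  greater than \<open>a\<close>.  The numbers \<open>\<nu> (a + 1) k\<close> and \<open>\<nu> a k\<close> mark the two ends of an interval of columns in row \<open>a + 1\<close> of the shifted
  diagram; the intervals are disjoint, and the reverse excited diagram consists of the cells outside them.
  A reverse excited move is then the same as increasing one entry of the pattern by one, that is, one entry
  of the tableau (\<open>increment_is_move\<close>, \<open>move_is_increment\<close>).  The initial diagram corresponds to the lowest pattern, from which
  all others are reached (\<open>broken_diagonals_rel_patterns\<close>).  The \<open>r\<close>-th broken diagonal lists the entries of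
  column \<open>r\<close> of the tableau, as rows, at columns given by the contents.  Since the diagram determines the
  pattern (\<open>pattern_diagram_inj\<close>), broken diagonals do not depend on the sequence of moves, and the product of
  arm lengths along them is the product attached to the tableau (\<open>prod_pattern_diagonals\<close>).
\<close>

section \<open>Shifted Schur functions and their Pieri rule\<close>

text \<open>
  Partitions are handled as sequences \<open>m\<close> with \<open>m k\<close> the length of row \<open>k + 1\<close>, so that boxes can be added
  and removed without changing lengths of lists.  The set is empty unless \<open>m\<close> is decreasing, and its
  members are then exactly the \<open>m'\<close> for which \<open>m / m'\<close> is a horizontal strip.
\<close>

definition interlacing :: "(nat \<Rightarrow> nat) \<Rightarrow> (nat \<Rightarrow> nat) set" where
  "interlacing m = {m'. \<forall>k. m (Suc k) \<le> m' k \<and> m' k \<le> m k}"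

text \<open>
  Cell \<open>(k + 1, r)\<close> has content \<open>r - k - 1\<close>: this is the product of \<open>x - c(u)\<close> over the strip \<open>m / m'\<close>.
\<close>

definition strip_weight :: "nat \<Rightarrow> nat \<Rightarrow> (nat \<Rightarrow> nat) \<Rightarrow> (nat \<Rightarrow> nat) \<Rightarrow> real" where
  "strip_weight n x m m' = (\<Prod>k<n. \<Prod>r\<in>{m' k<..m k}. real x + real k + 1 - real r)"

text \<open>
  The shifted Schur function of Okounkov and Olshanski, defined by its branching rule: in the sum over
  reverse tableaux \<open>T\<close> of \<open>\<Prod>u. x\<^bsub>T(u)\<^esub> - c(u)\<close>, the cells with \<open>T(u) = 1\<close> form the strip \<open>m / m'\<close>.
\<close>

primrec shifted_schur :: "nat list \<Rightarrow> (nat \<Rightarrow> nat) \<Rightarrow> real" where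
  "shifted_schur [] m = (if m = (\<lambda>_. 0) then 1 else 0)"
| "shifted_schur (x # xs) m =
     (\<Sum>m'\<in>interlacing m. strip_weight (Suc (length xs)) x m m' * shifted_schur xs m')"

lemma finite_bounded_seqs:
  fixes b :: "nat \<Rightarrow> nat"
  assumes "\<And>k. n \<le> k \<Longrightarrow> b k = 0"
  shows "finite {f. \<forall>k. f k \<le> b k}"
proof (rule finite_subset)
  show "finite {f. \<forall>k. (k \<in> {..<n} \<longrightarrow> f k \<in> {..sum b {..<n}}) \<and> (k \<notin> {..<n} \<longrightarrow> f k = (0::nat))}"
    by (rule finite_set_of_finite_funs) auto
  have "b k \<le> sum b {..<n}" if "k < n" for k
    using that by (intro member_le_sum) auto
  then show "{f. \<forall>k. f k \<le> b k}
      \<subseteq> {f. \<forall>k. (k \<in> {..<n} \<longrightarrow> f k \<in> {..sum b {..<n}}) \<and> (k \<notin> {..<n} \<longrightarrow> f k = (0::nat))}"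
    using assms by (auto intro: le_trans) (metis le_zero_eq not_less)
qed

lemma finite_interlacing:
  assumes "\<And>k. n \<le> k \<Longrightarrow> m k = 0"
  shows "finite (interlacing m)"
  by (rule finite_subset[OF _ finite_bounded_seqs[OF assms]]) (auto simp: interlacing_def)

lemma interlacing_antimono:
  assumes "m' \<in> interlacing m"
  shows "antimono m" and "antimono m'"
  using assms by (auto simp: interlacing_def decseq_Suc_iff intro: order_trans)

lemma shifted_schur_eq_0_if_not_antimono:
  assumes "\<not> antimono m"
  shows "shifted_schur xs m = 0"
proof (cases xs)
  case Nil
  then show ?thesis using assms by (auto simp: antimono_def)
next
  case (Cons x ys)
  have "interlacing m = {}" using assms interlacing_antimono(1) by blast
  then show ?thesis by (simp add: Cons)
qed

lemma shifted_schur_eq_0_if_too_long: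
  assumes "length xs \<le> k" "0 < m k"
  shows "shifted_schur xs m = 0"
  using assms
proof (induction xs arbitrary: k m)
  case Nil
  then show ?case by auto
next
  case (Cons x xs)
  obtain k' where k: "k = Suc k'" "length xs \<le> k'" using Cons.prems(1) by (cases k) auto
  have "shifted_schur xs m' = 0" if "m' \<in> interlacing m" for m'
    using that Cons.IH[OF k(2), of m'] Cons.prems(2) k(1)
    by (auto simp: interlacing_def dest: spec[of _ k'])
  then show ?case by (simp add: sum.neutral)
qed

lemma strip_weight_grow_outer:
  assumes "k < n" "m' k \<le> m k"
  shows "strip_weight n x (m(k := Suc (m k))) m'
    = strip_weight n x m m' * (real x + real k - real (m k))"
proof -
  have i: "{m' k<..Suc (m k)} = insert (Suc (m k)) {m' k<..m k}" using assms(2) by auto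
  have "strip_weight n x (m(k := Suc (m k))) m'
      = (\<Prod>r\<in>{m' k<..Suc (m k)}. real x + real k + 1 - real r)
        * (\<Prod>l\<in>{..<n} - {k}. \<Prod>r\<in>{m' l<..m l}. real x + real l + 1 - real r)"
    unfolding strip_weight_def using assms(1)
    by (subst prod.remove[of _ k]) (auto intro!: prod.cong)
  also have "\<dots> = strip_weight n x m m' * (real x + real k - real (m k))"
    unfolding strip_weight_def i using assms(1) by (subst (2) prod.remove[of _ k]) auto
  finally show ?thesis .
qed

lemma strip_weight_shrink_inner:
  assumes "k < n" "m' k < m k"
  shows "strip_weight n x m m'
    = strip_weight n x m (m'(k := Suc (m' k))) * (real x + real k - real (m' k))"
proof -
  have i: "{m' k<..m k} = insert (Suc (m' k)) {Suc (m' k)<..m k}" using assms(2) by auto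
  have "strip_weight n x m (m'(k := Suc (m' k)))
      = (\<Prod>r\<in>{Suc (m' k)<..m k}. real x + real k + 1 - real r)
        * (\<Prod>l\<in>{..<n} - {k}. \<Prod>r\<in>{m' l<..m l}. real x + real l + 1 - real r)"
    unfolding strip_weight_def using assms(1)
    by (subst prod.remove[of _ k]) (auto intro!: prod.cong)
  then show ?thesis
    unfolding strip_weight_def using assms(1) by (subst prod.remove[of _ k]) (auto simp: i)
qed

text \<open>
  Row \<open>k\<close> of the strip is empty before and after a box is added to it in both shapes.
\<close>

lemma strip_weight_shift_empty_row:
  assumes "m' k = m k"
  shows "strip_weight n x (m(k := Suc (m k))) (m'(k := Suc (m' k))) = strip_weight n x m m'"
proof -
  have "{(m'(k := Suc (m' k))) l<..(m(k := Suc (m k))) l} = {m' l<..m l}" for l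
    using assms by simp
  then show ?thesis unfolding strip_weight_def by simp
qed

text \<open>
  The upper bound on row \<open>k\<close> is attained on both sides.  The left side also asks that \<open>\<rho> (k - 1)\<close> be larger than
  \<open>m k\<close>, the right side that \<open>m k\<close> be at least \<open>m (k + 1)\<close>; the one holds because \<open>\<rho>\<close> is decreasing, the other
  because \<open>m\<close> is.
\<close>

lemma interlacing_grow_both:
  assumes "antimono m" "antimono \<rho>" "\<rho> k = Suc (m k)"
  shows "\<rho> \<in> interlacing (m(k := Suc (m k))) \<longleftrightarrow> \<rho>(k := m k) \<in> interlacing m"
proof -
  have a: "\<rho> (Suc l) \<le> \<rho> l" "m (Suc l) \<le> m l" for l
    using assms(1,2) by (auto simp: decseq_Suc_iff)
  have "(m (Suc l) \<le> (\<rho>(k := m k)) l \<and> (\<rho>(k := m k)) l \<le> m l)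
     \<longleftrightarrow> ((m(k := Suc (m k))) (Suc l) \<le> \<rho> l \<and> \<rho> l \<le> (m(k := Suc (m k))) l)" for l
    using a(1)[of l] a(2)[of l] a(2)[of k] assms(3) by (cases "l = k"; cases "Suc l = k") auto
  then show ?thesis unfolding interlacing_def by simp
qed

text \<open>
  Extending the weight by zero lets the three sums in the Pieri rule run over one common set of inner
  shapes, where they can be compared term by term.
\<close>

definition interlacing_weight :: "nat \<Rightarrow> nat \<Rightarrow> (nat \<Rightarrow> nat) \<Rightarrow> (nat \<Rightarrow> nat) \<Rightarrow> real" where
  "interlacing_weight n x m m' = (if m' \<in> interlacing m then strip_weight n x m m' else 0)"

text \<open>
  If \<open>\<rho>\<close> does not interlace \<open>m\<close>, one box can repair this only if it is added to a row \<open>k\<close> with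
  \<open>\<rho> k = m k + 1\<close>.  Adding it to \<open>m\<close> or removing it from \<open>\<rho>\<close> then leaves the same strip.
\<close>

lemma interlacing_weight_grow_cases:
  assumes "antimono m" "antimono \<rho>" "\<rho> \<notin> interlacing m" "k < n"
  shows "interlacing_weight n x (m(k := Suc (m k))) \<rho>
    = (if 0 < \<rho> k then interlacing_weight n x m (\<rho>(k := \<rho> k - 1)) else 0)"
proof (cases "\<rho> k = Suc (m k)")
  case True
  have "strip_weight n x (m(k := Suc (m k))) ((\<rho>(k := m k))(k := Suc ((\<rho>(k := m k)) k)))
      = strip_weight n x m (\<rho>(k := m k))"
    by (rule strip_weight_shift_empty_row) simp
  moreover have "(\<rho>(k := m k))(k := Suc ((\<rho>(k := m k)) k)) = \<rho>" using True by auto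
  ultimately have "strip_weight n x (m(k := Suc (m k))) \<rho> = strip_weight n x m (\<rho>(k := m k))"
    by metis
  then show ?thesis
    using interlacing_grow_both[OF assms(1,2) True] True by (simp add: interlacing_weight_def)
next
  case False
  obtain l where l: "\<not> (m (Suc l) \<le> \<rho> l \<and> \<rho> l \<le> m l)"
    using assms(3) by (auto simp: interlacing_def)
  have "\<rho> \<notin> interlacing (m(k := Suc (m k)))"
  proof
    assume "\<rho> \<in> interlacing (m(k := Suc (m k)))"
    then have "(m(k := Suc (m k))) (Suc l) \<le> \<rho> l \<and> \<rho> l \<le> (m(k := Suc (m k))) l"
      by (auto simp: interlacing_def)
    then show False using l False by (cases "l = k"; cases "Suc l = k") auto
  qed
  moreover have "\<rho>(k := \<rho> k - 1) \<notin> interlacing m" if "0 < \<rho> k"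
  proof
    assume "\<rho>(k := \<rho> k - 1) \<in> interlacing m"
    then have "m (Suc i) \<le> (\<rho>(k := \<rho> k - 1)) i \<and> (\<rho>(k := \<rho> k - 1)) i \<le> m i" for i
      unfolding interlacing_def by blast
    from this[of l] this[of k] show False using l False that by (cases "l = k") auto
  qed
  ultimately show ?thesis by (simp add: interlacing_weight_def)
qed

text \<open>
  Adding a box to row \<open>k + 1\<close> of \<open>m\<close> and removing one from row \<open>k\<close> of \<open>\<rho>\<close> are both blocked exactly when
  \<open>\<rho> k = m (k + 1)\<close>, which is where the difference of the two weights would vanish anyway.  This is why
  the two are paired with a shift of the row index.
\<close>

lemma interlacing_weight_telescope:
  assumes "\<rho> \<in> interlacing m" "Suc k < n"
  shows "interlacing_weight n x (m(Suc k := Suc (m (Suc k)))) \<rho>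
     - (if 0 < \<rho> k then interlacing_weight n x m (\<rho>(k := \<rho> k - 1)) else 0)
    = strip_weight n x m \<rho> * (real (\<rho> k) - real (m (Suc k)))"
proof -
  have b: "m (Suc l) \<le> \<rho> l" "\<rho> l \<le> m l" for l using assms(1) by (auto simp: interlacing_def)
  show ?thesis
  proof (cases "\<rho> k = m (Suc k)")
    case True
    have "\<rho> \<notin> interlacing (m(Suc k := Suc (m (Suc k))))"
      using True by (auto simp: interlacing_def intro!: exI[of _ k])
    moreover have "\<rho>(k := \<rho> k - 1) \<notin> interlacing m" if "0 < \<rho> k"
      using True that by (auto simp: interlacing_def intro!: exI[of _ k])
    ultimately show ?thesis using True by (simp add: interlacing_weight_def)
  next
    case False
    with b(1)[of k] have lt: "m (Suc k) < \<rho> k" by simp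
    have "\<rho> \<in> interlacing (m(Suc k := Suc (m (Suc k))))"
      using b lt by (auto simp: interlacing_def le_Suc_eq)
    moreover have "\<rho>(k := \<rho> k - 1) \<in> interlacing m"
    proof -
      have "m (Suc i) \<le> (\<rho>(k := \<rho> k - 1)) i \<and> (\<rho>(k := \<rho> k - 1)) i \<le> m i" for i
        using b(1)[of i] b(2)[of i] lt by (cases "i = k") auto
      then show ?thesis by (simp add: interlacing_def)
    qed
    moreover have "strip_weight n x m (\<rho>(k := \<rho> k - 1))
        = strip_weight n x m \<rho> * (real x + real (Suc k) - real (\<rho> k))"
      using strip_weight_shrink_inner[of k n "\<rho>(k := \<rho> k - 1)" m x] assms(2) lt b(2)[of k]
      by (simp add: of_nat_diff fun_upd_idem)
    moreover have "strip_weight n x (m(Suc k := Suc (m (Suc k)))) \<rho>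
        = strip_weight n x m \<rho> * (real x + real (Suc k) - real (m (Suc k)))"
      using strip_weight_grow_outer[of "Suc k" n \<rho> m x] assms(2) b(2) by simp
    ultimately show ?thesis using lt by (simp add: interlacing_weight_def algebra_simps)
  qed
qed

text \<open>
  The Pieri rule for a single inner shape \<open>\<rho>\<close>.  When \<open>\<rho>\<close> interlaces \<open>m\<close>, row 0 of \<open>m\<close> is unpaired and
  contributes \<open>x - m 0\<close>; the other contributions telescope.
\<close>

lemma interlacing_weight_pieri:
  assumes "antimono m" "antimono \<rho>" "\<rho> n = 0"
  shows "(\<Sum>k<Suc n. interlacing_weight (Suc n) x (m(k := Suc (m k))) \<rho>)
    = interlacing_weight (Suc n) x m \<rho> * (real x - (\<Sum>k<Suc n. real (m k)) + (\<Sum>k<n. real (\<rho> k)))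
      + (\<Sum>k<n. if 0 < \<rho> k then interlacing_weight (Suc n) x m (\<rho>(k := \<rho> k - 1)) else 0)"
    (is "?L = _ * ?c + (\<Sum>k<n. ?V k)")
proof (cases "\<rho> \<in> interlacing m")
  case True
  then have b: "m (Suc l) \<le> \<rho> l" "\<rho> l \<le> m l" for l by (auto simp: interlacing_def)
  have "m(0 := Suc (m 0)) = (\<lambda>l. if l = 0 then Suc (m 0) else m l)" by auto
  then have "\<rho> \<in> interlacing (m(0 := Suc (m 0)))"
    using b by (auto simp: interlacing_def le_Suc_eq)
  then have "interlacing_weight (Suc n) x (m(0 := Suc (m 0))) \<rho>
      = strip_weight (Suc n) x m \<rho> * (real x - real (m 0))"
    using strip_weight_grow_outer[of 0 "Suc n" \<rho> m x] b(2) by (simp add: interlacing_weight_def)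
  moreover have "?L - (\<Sum>k<n. ?V k) = interlacing_weight (Suc n) x (m(0 := Suc (m 0))) \<rho>
      + (\<Sum>k<n. interlacing_weight (Suc n) x (m(Suc k := Suc (m (Suc k)))) \<rho> - ?V k)"
    by (simp add: sum.lessThan_Suc_shift sum_subtractf del: sum.lessThan_Suc)
  moreover have "(\<Sum>k<n. interlacing_weight (Suc n) x (m(Suc k := Suc (m (Suc k)))) \<rho> - ?V k)
      = (\<Sum>k<n. strip_weight (Suc n) x m \<rho> * (real (\<rho> k) - real (m (Suc k))))"
    using interlacing_weight_telescope[OF True, of _ "Suc n" x] by (intro sum.cong refl) simp
  ultimately have "?L - (\<Sum>k<n. ?V k) = strip_weight (Suc n) x m \<rho> * (real x - real (m 0))
      + strip_weight (Suc n) x m \<rho> * (\<Sum>k<n. real (\<rho> k) - real (m (Suc k)))"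
    by (simp only: sum_distrib_left)
  then have "?L - (\<Sum>k<n. ?V k) = strip_weight (Suc n) x m \<rho> * ?c"
    by (simp only: sum.lessThan_Suc_shift sum_subtractf) (simp add: algebra_simps)
  then show ?thesis using True by (simp add: interlacing_weight_def)
next
  case False
  have "?L = (\<Sum>k<Suc n. ?V k)"
    by (rule sum.cong[OF refl], rule interlacing_weight_grow_cases[OF assms(1,2) False]) simp
  then show ?thesis using False assms(3) by (simp add: interlacing_weight_def)
qed

text \<open>
  This is \<open>(|x| - |m|) s\<^sup>*\<^bsub>m\<^esub> = \<Sum> s\<^sup>*\<^bsub>n\<^esub>\<close>, with \<open>n\<close> ranging over the shapes with one more box than \<open>m\<close>.  Branching
  off the first variable, both sides become sums over \<open>\<rho>\<close> of a weight times \<open>s\<^sup>*\<^bsub>\<rho>\<^esub>\<close> in the remaining variables: the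
  induction hypothesis absorbs \<open>|x| - |\<rho>|\<close>, taken over those variables, by adding a box to \<open>\<rho>\<close>; the weights then
  agree for each \<open>\<rho>\<close>.
\<close>

lemma shifted_schur_pieri:
  assumes "antimono m"
  shows "(real (sum_list xs) - (\<Sum>k<length xs. real (m k))) * shifted_schur xs m
    = (\<Sum>k<length xs. shifted_schur xs (m(k := Suc (m k))))"
  using assms
proof (induction xs arbitrary: m)
  case Nil
  then show ?case by simp
next
  case (Cons x xs)
  define n where "n = length xs"
  show ?case
  proof (cases "\<exists>k\<ge>Suc n. 0 < m k")
    case True
    then obtain k where k: "Suc n \<le> k" "0 < m k" by auto
    then have "shifted_schur (x # xs) m = 0"
      using shifted_schur_eq_0_if_too_long[of "x # xs" k m] by (simp add: n_def del: shifted_schur.simps)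
    moreover have "shifted_schur (x # xs) (m(l := Suc (m l))) = 0" for l
      using shifted_schur_eq_0_if_too_long[of "x # xs" k "m(l := Suc (m l))"] k
      by (simp add: n_def del: shifted_schur.simps)
    ultimately show ?thesis by (simp only: mult_zero_right sum.neutral_const)
  next
    case False
    then have m0: "m k = 0" if "Suc n \<le> k" for k using that by auto
    \<comment> \<open>Contains every shape that interlaces \<open>m\<close> or \<open>m\<close> with one box added.\<close>
    define Box where "Box = {\<rho>. \<forall>k. \<rho> k \<le> (if k \<le> n then Suc (m k) else 0)}"
    have fin: "finite Box" unfolding Box_def by (rule finite_bounded_seqs[of "Suc n"]) auto
    have exp: "shifted_schur (x # xs) m' = (\<Sum>\<rho>\<in>Box. interlacing_weight (Suc n) x m' \<rho> * shifted_schur xs \<rho>)"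
      if "interlacing m' \<subseteq> Box" for m'
      using that fin unfolding shifted_schur.simps n_def[symmetric]
      by (intro sum.mono_neutral_cong_left) (auto simp: interlacing_weight_def)
    have bound: "\<rho> k \<le> (if k \<le> n then m k else 0)" if "\<rho> \<in> interlacing m" for \<rho> k
      using that m0[of k] by (auto simp: interlacing_def not_le) (metis le_zero_eq)
    have sub: "interlacing m \<subseteq> Box"
    proof
      fix \<rho> assume "\<rho> \<in> interlacing m"
      then have "\<rho> l \<le> (if l \<le> n then Suc (m l) else 0)" for l
        using bound[of \<rho> l] by (simp add: le_SucI split: if_splits)
      then show "\<rho> \<in> Box" unfolding Box_def by blast
    qed
    have sub_up: "interlacing (m(k := Suc (m k))) \<subseteq> Box" if "k \<le> n" for k
    proof
      fix \<rho> assume "\<rho> \<in> interlacing (m(k := Suc (m k)))"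
      then have "\<rho> l \<le> (m(k := Suc (m k))) l" for l by (auto simp: interlacing_def)
      moreover have "(m(k := Suc (m k))) l \<le> (if l \<le> n then Suc (m l) else 0)" for l
        using that m0[of l] by auto
      ultimately show "\<rho> \<in> Box" unfolding Box_def using order_trans by blast
    qed
    have shift: "(\<Sum>\<nu>\<in>interlacing m. strip_weight (Suc n) x m \<nu> * shifted_schur xs (\<nu>(k := Suc (\<nu> k))))
      = (\<Sum>\<rho>\<in>Box. (if 0 < \<rho> k then interlacing_weight (Suc n) x m (\<rho>(k := \<rho> k - 1)) else 0) * shifted_schur xs \<rho>)"
      if "k < n" for k
    proof -
      have "(\<Sum>\<nu>\<in>interlacing m. strip_weight (Suc n) x m \<nu> * shifted_schur xs (\<nu>(k := Suc (\<nu> k))))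
        = (\<Sum>\<rho>\<in>{\<rho>\<in>Box. 0 < \<rho> k \<and> \<rho>(k := \<rho> k - 1) \<in> interlacing m}.
            (if 0 < \<rho> k then interlacing_weight (Suc n) x m (\<rho>(k := \<rho> k - 1)) else 0) * shifted_schur xs \<rho>)"
      proof (rule sum.reindex_bij_witness[of _ "\<lambda>\<rho>. \<rho>(k := \<rho> k - 1)" "\<lambda>\<nu>. \<nu>(k := Suc (\<nu> k))"], goal_cases)
        case (2 \<nu>)
        have "(\<nu>(k := Suc (\<nu> k))) l \<le> (if l \<le> n then Suc (m l) else 0)" for l
          using bound[OF 2, of l] \<open>k < n\<close> by (cases "l = k") (auto split: if_splits)
        then have "\<nu>(k := Suc (\<nu> k)) \<in> Box" unfolding Box_def by blast
        then show ?case using 2 by simp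
      qed (auto simp: interlacing_weight_def fun_upd_idem)
      also have "\<dots> = (\<Sum>\<rho>\<in>Box. (if 0 < \<rho> k then interlacing_weight (Suc n) x m (\<rho>(k := \<rho> k - 1)) else 0) * shifted_schur xs \<rho>)"
        using fin by (intro sum.mono_neutral_left) (auto simp: interlacing_weight_def)
      finally show ?thesis .
    qed
    have "(\<Sum>k<Suc n. shifted_schur (x # xs) (m(k := Suc (m k))))
      = (\<Sum>k<Suc n. \<Sum>\<rho>\<in>Box. interlacing_weight (Suc n) x (m(k := Suc (m k))) \<rho> * shifted_schur xs \<rho>)"
      by (intro sum.cong refl exp sub_up) simp
    also have "\<dots> = (\<Sum>\<rho>\<in>Box. (\<Sum>k<Suc n. interlacing_weight (Suc n) x (m(k := Suc (m k))) \<rho>) * shifted_schur xs \<rho>)"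
      by (subst sum.swap) (simp only: sum_distrib_right)
    also have "\<dots> = (\<Sum>\<rho>\<in>Box. (interlacing_weight (Suc n) x m \<rho> * (real x - (\<Sum>k<Suc n. real (m k)) + (\<Sum>k<n. real (\<rho> k)))
      + (\<Sum>k<n. if 0 < \<rho> k then interlacing_weight (Suc n) x m (\<rho>(k := \<rho> k - 1)) else 0)) * shifted_schur xs \<rho>)"
    proof (rule sum.cong[OF refl])
      fix \<rho>
      show "(\<Sum>k<Suc n. interlacing_weight (Suc n) x (m(k := Suc (m k))) \<rho>) * shifted_schur xs \<rho>
        = (interlacing_weight (Suc n) x m \<rho> * (real x - (\<Sum>k<Suc n. real (m k)) + (\<Sum>k<n. real (\<rho> k)))
          + (\<Sum>k<n. if 0 < \<rho> k then interlacing_weight (Suc n) x m (\<rho>(k := \<rho> k - 1)) else 0)) * shifted_schur xs \<rho>"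
      proof (cases "antimono \<rho> \<and> \<rho> n = 0")
        case True
        then show ?thesis using interlacing_weight_pieri[OF Cons.prems, of \<rho> n x] by simp
      next
        case False
        then have "shifted_schur xs \<rho> = 0"
          using shifted_schur_eq_0_if_not_antimono shifted_schur_eq_0_if_too_long[of xs n \<rho>]
          by (auto simp: n_def)
        then show ?thesis by simp
      qed
    qed
    also have "\<dots> = (\<Sum>\<rho>\<in>Box. interlacing_weight (Suc n) x m \<rho> * shifted_schur xs \<rho> * (real x - (\<Sum>k<Suc n. real (m k)) + (\<Sum>k<n. real (\<rho> k))))
       + (\<Sum>k<n. \<Sum>\<rho>\<in>Box. (if 0 < \<rho> k then interlacing_weight (Suc n) x m (\<rho>(k := \<rho> k - 1)) else 0) * shifted_schur xs \<rho>)"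
      unfolding distrib_right sum.distrib sum_distrib_right
      by (subst sum.swap) (simp only: mult_ac)
    also have "(\<Sum>k<n. \<Sum>\<rho>\<in>Box. (if 0 < \<rho> k then interlacing_weight (Suc n) x m (\<rho>(k := \<rho> k - 1)) else 0) * shifted_schur xs \<rho>)
      = (\<Sum>k<n. \<Sum>\<nu>\<in>interlacing m. strip_weight (Suc n) x m \<nu> * shifted_schur xs (\<nu>(k := Suc (\<nu> k))))"
      by (intro sum.cong refl shift[symmetric]) simp
    also have "\<dots> = (\<Sum>\<nu>\<in>interlacing m. strip_weight (Suc n) x m \<nu> * (\<Sum>k<n. shifted_schur xs (\<nu>(k := Suc (\<nu> k)))))"
      by (subst sum.swap) (simp only: sum_distrib_left)
    also have "\<dots> = (\<Sum>\<nu>\<in>interlacing m. strip_weight (Suc n) x m \<nu> * ((real (sum_list xs) - (\<Sum>k<n. real (\<nu> k))) * shifted_schur xs \<nu>))"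
      unfolding n_def by (intro sum.cong refl) (simp only: Cons.IH[OF interlacing_antimono(2)])
    also have "\<dots> = (\<Sum>\<rho>\<in>Box. interlacing_weight (Suc n) x m \<rho> * ((real (sum_list xs) - (\<Sum>k<n. real (\<rho> k))) * shifted_schur xs \<rho>))"
      using fin sub by (intro sum.mono_neutral_cong_left) (auto simp: interlacing_weight_def)
    also have "(\<Sum>\<rho>\<in>Box. interlacing_weight (Suc n) x m \<rho> * shifted_schur xs \<rho> * (real x - (\<Sum>k<Suc n. real (m k)) + (\<Sum>k<n. real (\<rho> k)))) + \<dots>
      = (real (sum_list (x # xs)) - (\<Sum>k<Suc n. real (m k))) * shifted_schur (x # xs) m"
      unfolding exp[OF sub] sum_distrib_left sum.distrib[symmetric]
      by (intro sum.cong refl) (simp add: algebra_simps)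
    finally show ?thesis by (simp add: n_def del: sum.lessThan_Suc shifted_schur.simps)
  qed
qed

section \<open>Vanishing, and the value at the partition itself\<close>

lemma part_Cons [simp]:
  "part (x # xs) (Suc 0) = x"
  "part (x # xs) (Suc (Suc k)) = part xs (Suc k)"
  by (auto simp: part_def)

lemma part_Nil [simp]: "part [] i = 0"
  by (simp add: part_def)

lemma part_antimono:
  assumes "is_partition lam" "1 \<le> i" "i \<le> i'"
  shows "part lam i' \<le> part lam i"
proof (cases "i = i'")
  case False
  have "sorted_wrt (\<ge>) lam" using assms(1) by (simp add: is_partition_def)
  then show ?thesis
    using False assms(2,3) sorted_wrt_nth_less[of "(\<ge>)" lam "i - 1" "i' - 1"]
    by (auto simp: part_def)
qed simp

lemma is_partition_Cons:
  "is_partition (x # xs) \<longleftrightarrow> 0 < x \<and> (\<forall>y\<in>set xs. y \<le> x) \<and> is_partition xs"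
  by (auto simp: is_partition_def)

lemma part_le_head:
  assumes "is_partition (x # xs)"
  shows "part xs i \<le> x"
  using assms by (auto simp: is_partition_Cons part_def)

lemma initial_segment:
  fixes A :: "nat set"
  assumes "finite A" "0 \<notin> A" "\<And>i i'. i' \<in> A \<Longrightarrow> 1 \<le> i \<Longrightarrow> i \<le> i' \<Longrightarrow> i \<in> A"
  shows "A = {1..card A}"
proof (cases "A = {}")
  case False
  have "A = {1..Max A}"
  proof (intro equalityI subsetI)
    show "i \<in> {1..Max A}" if "i \<in> A" for i
      using that assms(1,2) by (cases i) (auto intro: Max_ge)
    show "i \<in> A" if "i \<in> {1..Max A}" for i
      using that assms(3)[OF Max_in[OF assms(1) False]] by auto
  qed
  then show ?thesis by (metis card_atLeastAtMost diff_Suc_1)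
qed simp

lemma conj_part_galois:
  assumes "is_partition lam" "1 \<le> i" "1 \<le> r"
  shows "i \<le> conj_part lam r \<longleftrightarrow> r \<le> part lam i"
proof -
  let ?A = "{i. 1 \<le> i \<and> i \<le> length lam \<and> r \<le> part lam i}"
  have "?A = {1..card ?A}"
    using part_antimono[OF assms(1)] by (intro initial_segment) (auto intro: order_trans)
  then have "i \<in> ?A \<longleftrightarrow> i \<in> {1..card ?A}" by simp
  moreover have "i \<le> length lam" if "r \<le> part lam i"
    using that assms(3) by (simp add: part_def split: if_splits)
  ultimately show ?thesis using assms(2,3) by (auto simp: conj_part_def)
qed

text \<open>
  The factor of the strip at \<open>r = y + k + 1\<close> is zero, where \<open>y\<close> is the first variable.  A nonzero summand must therefore
  already have \<open>m' k > y + k\<close>, and this persists through all the variables because they decrease.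
\<close>

lemma shifted_schur_eq_0_if_exceeds_bound:
  assumes "is_partition xs" "\<forall>y\<in>set xs. y \<le> x" "x + k < m k"
  shows "shifted_schur xs m = 0"
  using assms
proof (induction xs arbitrary: x m)
  case Nil
  then show ?case by auto
next
  case (Cons y ys)
  show ?case
  proof (cases "Suc (length ys) \<le> k")
    case True
    then show ?thesis using shifted_schur_eq_0_if_too_long[of "y # ys" k m] Cons.prems(3) by simp
  next
    case False
    have "strip_weight (Suc (length ys)) y m m' * shifted_schur ys m' = 0"
      if m': "m' \<in> interlacing m" for m'
    proof (cases "y + k < m' k")
      case True
      then show ?thesis using Cons.IH[of y m'] Cons.prems by (simp add: is_partition_Cons)
    next
      case le: False
      have "(\<Prod>r\<in>{m' k<..m k}. real y + real k + 1 - real r) = 0"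
        using le Cons.prems by (intro prod_zero) (auto intro!: bexI[of _ "Suc (y + k)"])
      then have "strip_weight (Suc (length ys)) y m m' = 0"
        unfolding strip_weight_def using False by (intro prod_zero) auto
      then show ?thesis by simp
    qed
    then show ?thesis by (simp add: sum.neutral)
  qed
qed

text \<open>
  In row 0 this is the previous bound.  Otherwise \<open>m k \<le> m' (k - 1)\<close>, so the violation moves up one row
  each time a variable is branched off.
\<close>

lemma shifted_schur_eq_0_if_not_contained:
  assumes "is_partition xs" "part xs (Suc k) < m k"
  shows "shifted_schur xs m = 0"
  using assms
proof (induction xs arbitrary: k m)
  case Nil
  then show ?case by auto
next
  case (Cons x xs)
  show ?case
  proof (cases k)
    case 0
    then show ?thesis
      using shifted_schur_eq_0_if_exceeds_bound[of "x # xs" x 0 m] Cons.prems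
      by (simp add: is_partition_Cons)
  next
    case (Suc l)
    have "shifted_schur xs m' = 0" if "m' \<in> interlacing m" for m'
    proof -
      have "m k \<le> m' l" using that by (auto simp: interlacing_def Suc)
      then show ?thesis using Cons.IH[of l m'] Cons.prems by (simp add: Suc is_partition_Cons)
    qed
    then show ?thesis by (simp add: sum.neutral)
  qed
qed

lemma part_interlacing:
  assumes "is_partition (x # xs)"
  shows "(\<lambda>k. part xs (Suc k)) \<in> interlacing (\<lambda>k. part (x # xs) (Suc k))"
proof -
  have "part xs (Suc k) \<le> part (x # xs) (Suc k)" for k
    using part_le_head[OF assms] part_antimono[of xs "k" "Suc k"] assms
    by (cases k) (auto simp: is_partition_Cons)
  then show ?thesis by (simp add: interlacing_def)
qed

text \<open>
  Column \<open>r\<close> has \<open>k + 1\<close> cells precisely when \<open>r\<close> lies in row \<open>k\<close> of the strip between the partition and itself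
  without its first part; the hook length of \<open>(1, r)\<close> is then \<open>x + k + 1 - r\<close>.
\<close>

lemma first_row_hooks:
  assumes "is_partition (x # xs)"
  shows "(\<Prod>j\<in>{1..x}. real_of_int (hook (x # xs) (1, j)))
    = strip_weight (Suc (length xs)) x (\<lambda>k. part (x # xs) (Suc k)) (\<lambda>k. part xs (Suc k))"
proof -
  let ?l = "x # xs"
  have col: "r \<in> {1..x} \<and> conj_part ?l r - 1 = k \<longleftrightarrow> r \<in> {part xs (Suc k)<..part ?l (Suc k)}" for r k
  proof (cases "1 \<le> r")
    case True
    have "1 \<le> conj_part ?l r \<longleftrightarrow> r \<le> x"
      using conj_part_galois[OF assms _ True, of 1] by simp
    moreover have "Suc k \<le> conj_part ?l r \<longleftrightarrow> r \<le> part ?l (Suc k)"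
      using conj_part_galois[OF assms _ True, of "Suc k"] by simp
    moreover have "Suc (Suc k) \<le> conj_part ?l r \<longleftrightarrow> r \<le> part xs (Suc k)"
      using conj_part_galois[OF assms _ True, of "Suc (Suc k)"] by simp
    ultimately show ?thesis using True by auto
  qed auto
  have "conj_part ?l r - 1 < Suc (length xs)" if "r \<in> {1..x}" for r
    using col[of r "conj_part ?l r - 1"] that by (auto simp: part_def split: if_splits)
  then have "(\<lambda>r. conj_part ?l r - 1) ` {1..x} \<subseteq> {..<Suc (length xs)}" by blast
  then have "(\<Prod>j\<in>{1..x}. real_of_int (hook ?l (1, j)))
     = (\<Prod>k<Suc (length xs). \<Prod>r\<in>{r\<in>{1..x}. conj_part ?l r - 1 = k}. real_of_int (hook ?l (1, r)))"
    by (intro prod.group[symmetric]) auto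
  also have "\<dots> = strip_weight (Suc (length xs)) x (\<lambda>k. part ?l (Suc k)) (\<lambda>k. part xs (Suc k))"
    unfolding strip_weight_def
  proof (intro prod.cong refl)
    fix k show "{r\<in>{1..x}. conj_part ?l r - 1 = k} = {part xs (Suc k)<..part ?l (Suc k)}"
      using col by blast
    fix r assume r: "r \<in> {part xs (Suc k)<..part ?l (Suc k)}"
    then have "Suc k \<le> conj_part ?l r" "conj_part ?l r - 1 = k"
      using conj_part_galois[OF assms, of "Suc k" r] col[of r k] by auto
    then have "conj_part ?l r = Suc k" by simp
    then show "real_of_int (hook ?l (1, r)) = real x + real k + 1 - real r"
      by (simp add: hook_def)
  qed
  finally show ?thesis .
qed

lemma hook_product_Cons:
  assumes "is_partition (x # xs)"
  shows "(\<Prod>u\<in>diagram (x # xs). real_of_int (hook (x # xs) u))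
    = (\<Prod>j\<in>{1..x}. real_of_int (hook (x # xs) (1, j))) * (\<Prod>u\<in>diagram xs. real_of_int (hook xs u))"
proof -
  have p: "part (x # xs) (Suc i) = (if i = 0 then x else part xs i)" for i
    by (cases i) (auto simp: part_def)
  have dia: "diagram (x # xs) = Pair 1 ` {1..x} \<union> (\<lambda>(i, j). (Suc i, j)) ` diagram xs"
  proof (intro equalityI subsetI)
    fix u assume "u \<in> diagram (x # xs)"
    then obtain i j where u: "u = (Suc i, j)" "i \<le> length xs" "1 \<le> j" "j \<le> part (x # xs) (Suc i)"
      by (cases u; cases "fst u") (auto simp: diagram_def)
    then show "u \<in> Pair 1 ` {1..x} \<union> (\<lambda>(i, j). (Suc i, j)) ` diagram xs"
      by (cases "i = 0") (auto simp: p diagram_def image_iff)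
  qed (auto simp: diagram_def p)
  have fin: "finite (diagram xs)"
  proof (rule finite_subset)
    show "diagram xs \<subseteq> {..length xs} \<times> {..x}"
      using part_le_head[OF assms] by (auto simp: diagram_def intro: order_trans)
  qed auto
  have hk: "hook (x # xs) (Suc i, j) = hook xs (i, j)" if "(i, j) \<in> diagram xs" for i j
  proof -
    from that have ij: "1 \<le> i" "1 \<le> j" "j \<le> part xs i" by (auto simp: diagram_def)
    have jx: "j \<le> x" using ij part_le_head[OF assms, of i] by simp
    have "{l. 1 \<le> l \<and> l \<le> length (x # xs) \<and> j \<le> part (x # xs) l}
        = insert 1 (Suc ` {l. 1 \<le> l \<and> l \<le> length xs \<and> j \<le> part xs l})"
    proof (intro equalityI subsetI)
      fix l assume "l \<in> {l. 1 \<le> l \<and> l \<le> length (x # xs) \<and> j \<le> part (x # xs) l}"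
      then show "l \<in> insert 1 (Suc ` {l. 1 \<le> l \<and> l \<le> length xs \<and> j \<le> part xs l})"
        by (cases l; cases "l = 1") (auto simp: p image_iff)
    qed (use jx in \<open>auto simp: p\<close>)
    then have "conj_part (x # xs) j = card (insert 1 (Suc ` {l. 1 \<le> l \<and> l \<le> length xs \<and> j \<le> part xs l}))"
      by (simp add: conj_part_def)
    also have "\<dots> = Suc (conj_part xs j)"
      unfolding conj_part_def by (subst card_insert_disjoint) (auto simp: card_image)
    finally show ?thesis using ij by (simp add: hook_def p)
  qed
  have inj: "inj_on (\<lambda>(i, j). (Suc i, j)) (diagram xs)" by (auto intro: inj_onI)
  show ?thesis
    unfolding dia using fin inj
    by (subst prod.union_disjoint)
       (auto simp: prod.reindex inj_on_def hk diagram_def intro!: arg_cong2[of _ _ _ _ "(*)"] prod.cong)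
qed

text \<open>
  Every \<open>m'\<close> interlacing the partition contains the partition of the remaining parts, and vanishing
  leaves only the one equal to it.
\<close>

lemma shifted_schur_self:
  assumes "is_partition lam"
  shows "shifted_schur lam (\<lambda>k. part lam (Suc k)) = (\<Prod>u\<in>diagram lam. real_of_int (hook lam u))"
  using assms
proof (induction lam)
  case Nil
  then show ?case by (auto simp: diagram_def intro!: prod.neutral)
next
  case (Cons x xs)
  let ?m = "\<lambda>k. part (x # xs) (Suc k)" and ?m' = "\<lambda>k. part xs (Suc k)"
  have fin: "finite (interlacing ?m)"
    by (rule finite_interlacing[of "Suc (length xs)"]) (simp add: part_def)
  have "shifted_schur xs m' = 0" if "m' \<in> interlacing ?m" "m' \<noteq> ?m'" for m'
  proof -
    from that(2) obtain k where "m' k \<noteq> ?m' k" by blast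
    moreover have "?m' k \<le> m' k" using that(1) by (auto simp: interlacing_def)
    ultimately show ?thesis
      using shifted_schur_eq_0_if_not_contained[of xs k m'] Cons.prems by (simp add: is_partition_Cons)
  qed
  then have "shifted_schur (x # xs) ?m
      = (\<Sum>m'\<in>{?m'}. strip_weight (Suc (length xs)) x ?m m' * shifted_schur xs m')"
    unfolding shifted_schur.simps using fin part_interlacing[OF Cons.prems]
    by (intro sum.mono_neutral_right) auto
  then show ?case
    using Cons.IH Cons.prems hook_product_Cons[OF Cons.prems] first_row_hooks[OF Cons.prems]
    by (simp add: is_partition_Cons)
qed

section \<open>Removing the smallest entry of a standard tableau\<close>

text \<open>
  The cells that can hold the entry 1.
\<close>

definition corners :: "cell set \<Rightarrow> cell set" where
  "corners S = {(i, j) \<in> S. (\<forall>j'. (i, j') \<in> S \<longrightarrow> j \<le> j') \<and> (\<forall>i'. (i', j) \<in> S \<longrightarrow> i \<le> i')}"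

lemma finite_standard_tableaux:
  assumes "finite S"
  shows "finite (standard_tableaux S)"
proof (rule finite_subset)
  show "standard_tableaux S \<subseteq> S \<rightarrow>\<^sub>E {1..card S}"
    by (auto simp: standard_tableaux_def PiE_def bij_betw_def)
  show "finite (S \<rightarrow>\<^sub>E {1..card S})" using assms by (intro finite_PiE) auto
qed

lemma one_in_corner:
  assumes "T \<in> standard_tableaux S" "u \<in> S" "T u = 1"
  shows "u \<in> corners S"
proof -
  obtain i j where u: "u = (i, j)" by (cases u)
  have pos: "1 \<le> T v" if "v \<in> S" for v
    using assms(1) that by (auto simp: standard_tableaux_def bij_betw_def)
  have "j \<le> j'" if "(i, j') \<in> S" for j'
    using assms u that pos[OF that] by (auto simp: standard_tableaux_def not_le[symmetric])
       (metis less_one not_less0 not_le)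
  moreover have "i \<le> i'" if "(i', j) \<in> S" for i'
    using assms u that pos[OF that] by (auto simp: standard_tableaux_def not_le[symmetric])
       (metis less_one not_less0 not_le)
  ultimately show ?thesis using assms(2) u by (auto simp: corners_def)
qed

lemma card_standard_tableaux_one_at:
  assumes fin: "finite S" and u: "u \<in> corners S"
  shows "card {T \<in> standard_tableaux S. T u = 1} = card (standard_tableaux (S - {u}))"
proof -
  obtain a b where ab: "u = (a, b)" by (cases u)
  have uS: "u \<in> S" using u by (auto simp: corners_def)
  have mincol: "b \<le> b'" if "(a, b') \<in> S" for b' using u that by (auto simp: corners_def ab)
  have minrow: "a \<le> a'" if "(a', b) \<in> S" for a' using u that by (auto simp: corners_def ab)
  have cS: "card S = Suc (card (S - {u}))" using card_Suc_Diff1[OF fin uS] by simp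
  let ?down = "\<lambda>T. restrict (\<lambda>v. T v - 1) (S - {u})"
  let ?up = "\<lambda>T. restrict (\<lambda>v. if v = u then 1 else Suc (T v)) S"
  have "bij_betw ?down {T \<in> standard_tableaux S. T u = 1} (standard_tableaux (S - {u}))"
  proof (rule bij_betw_byWitness[where f' = ?up])
    have pos: "1 < T v" if "T \<in> standard_tableaux S" "T u = 1" "v \<in> S" "v \<noteq> u" for T v
    proof -
      have b: "bij_betw T S {1..card S}" using that(1) by (simp add: standard_tableaux_def)
      then have "1 \<le> T v" using that(3) by (auto simp: bij_betw_def)
      moreover have "T v \<noteq> T u" using b that(3,4) uS by (auto simp: bij_betw_def inj_on_def)
      ultimately show ?thesis using that(2) by simp
    qed
    show "\<forall>T\<in>{T \<in> standard_tableaux S. T u = 1}. ?up (?down T) = T"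
    proof
      fix T assume T: "T \<in> {T \<in> standard_tableaux S. T u = 1}"
      then have ext: "T \<in> extensional S" by (simp add: standard_tableaux_def)
      show "?up (?down T) = T"
      proof
        fix v show "?up (?down T) v = T v"
          using T pos[of T v] uS extensional_arb[OF ext, of v] by (cases "v \<in> S") auto
      qed
    qed
    show "\<forall>T\<in>standard_tableaux (S - {u}). ?down (?up T) = T"
    proof
      fix T assume "T \<in> standard_tableaux (S - {u})"
      then have ext: "T \<in> extensional (S - {u})" by (simp add: standard_tableaux_def)
      show "?down (?up T) = T"
      proof
        fix v show "?down (?up T) v = T v"
          using extensional_arb[OF ext, of v] by (cases "v \<in> S - {u}") auto
      qed
    qed
    show "?down ` {T \<in> standard_tableaux S. T u = 1} \<subseteq> standard_tableaux (S - {u})"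
    proof (intro image_subsetI)
      fix T assume "T \<in> {T \<in> standard_tableaux S. T u = 1}"
      then have T: "T \<in> standard_tableaux S" "T u = 1" by auto
      have b: "bij_betw T S {1..card S}" using T(1) by (simp add: standard_tableaux_def)
      have "bij_betw T (S - {u}) ({1..card S} - {T u})"
        using b uS by (intro bij_betw_subset[OF b]) (auto simp: bij_betw_def inj_on_def)
      moreover have "bij_betw (\<lambda>x. x - 1) ({1..card S} - {T u}) {1..card (S - {u})}"
        using T(2) cS by (intro bij_betw_byWitness[where f' = Suc]) auto
      ultimately have "bij_betw ((\<lambda>x. x - 1) \<circ> T) (S - {u}) {1..card (S - {u})}"
        by (rule bij_betw_trans)
      then have "bij_betw (?down T) (S - {u}) {1..card (S - {u})}"
        by (rule bij_betw_cong[THEN iffD1, rotated]) auto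
      moreover have "T v - 1 < T w - 1" if "T v < T w" "v \<in> S - {u}" for v w
        using that pos[OF T, of v] by auto
      ultimately show "?down T \<in> standard_tableaux (S - {u})"
        using T(1) by (auto simp: standard_tableaux_def)
    qed
    show "?up ` standard_tableaux (S - {u}) \<subseteq> {T \<in> standard_tableaux S. T u = 1}"
    proof (intro image_subsetI)
      fix T assume T: "T \<in> standard_tableaux (S - {u})"
      then have b: "bij_betw T (S - {u}) {1..card (S - {u})}" by (simp add: standard_tableaux_def)
      have "bij_betw Suc {1..card (S - {u})} ({1..card S} - {1})"
        using cS by (intro bij_betw_byWitness[where f' = "\<lambda>x. x - 1"]) auto
      from bij_betw_trans[OF b this] have "bij_betw (Suc \<circ> T) (S - {u}) ({1..card S} - {1})" .
      then have "bij_betw (?up T) (S - {u}) ({1..card S} - {1})"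
        by (rule bij_betw_cong[THEN iffD1, rotated]) auto
      moreover have "?up T u = 1" using uS by simp
      ultimately have "bij_betw (?up T) (insert u (S - {u})) (insert 1 ({1..card S} - {1}))"
        using notIn_Un_bij_betw[of u "S - {u}" "?up T" "{1..card S} - {1}"] by simp
      moreover have "insert u (S - {u}) = S" "insert 1 ({1..card S} - {1}) = {1..card S}"
        using uS cS by auto
      ultimately have bu: "bij_betw (?up T) S {1..card S}" by simp
      have posT: "0 < T v" if "v \<in> S" "v \<noteq> u" for v
        using b that by (fastforce simp: bij_betw_def)
      have rows: "?up T (i, j) < ?up T (i, j')" if "(i, j) \<in> S" "(i, j') \<in> S" "j < j'" for i j j'
      proof (cases "(i, j) = u")
        case True
        then have "(i, j') \<noteq> u" using that(3) by auto
        then show ?thesis using True that posT[of "(i, j')"] by simp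
      next
        case False
        moreover have "(i, j') \<noteq> u" using mincol that ab by fastforce
        ultimately show ?thesis using T that by (auto simp: standard_tableaux_def)
      qed
      have cols: "?up T (i, j) < ?up T (i', j)" if "(i, j) \<in> S" "(i', j) \<in> S" "i < i'" for i i' j
      proof (cases "(i, j) = u")
        case True
        then have "(i', j) \<noteq> u" using that(3) by auto
        then show ?thesis using True that posT[of "(i', j)"] by simp
      next
        case False
        moreover have "(i', j) \<noteq> u" using minrow that ab by fastforce
        ultimately show ?thesis using T that by (auto simp: standard_tableaux_def)
      qed
      have "?up T \<in> extensional S" by simp
      with bu rows cols have "?up T \<in> standard_tableaux S"
        unfolding standard_tableaux_def by blast
      then show "?up T \<in> {T \<in> standard_tableaux S. T u = 1}" using uS by simp
    qed
  qed
  then show ?thesis by (rule bij_betw_same_card)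
qed

lemma card_standard_tableaux_rec:
  assumes "finite S" "S \<noteq> {}"
  shows "card (standard_tableaux S) = (\<Sum>u\<in>corners S. card (standard_tableaux (S - {u})))"
proof -
  have "\<exists>u\<in>S. T u = 1" if "T \<in> standard_tableaux S" for T
  proof -
    have "1 \<in> {1..card S}" using assms by (simp add: Suc_leI card_gt_0_iff)
    also have "{1..card S} = T ` S" using that by (simp add: standard_tableaux_def bij_betw_def)
    finally show ?thesis by auto
  qed
  then have cover: "standard_tableaux S = (\<Union>u\<in>corners S. {T \<in> standard_tableaux S. T u = 1})"
    using one_in_corner by blast
  moreover have "u = v" if "T \<in> standard_tableaux S" "T u = 1" "T v = 1" "u \<in> corners S" "v \<in> corners S"
    for T u v
  proof -
    have "inj_on T S" using that(1) by (simp add: standard_tableaux_def bij_betw_def)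
    moreover have "u \<in> S" "v \<in> S" using that(4,5) by (auto simp: corners_def)
    ultimately show ?thesis using that(2,3) by (simp add: inj_on_def)
  qed
  then have "\<forall>u\<in>corners S. \<forall>v\<in>corners S. u \<noteq> v \<longrightarrow>
      {T \<in> standard_tableaux S. T u = 1} \<inter> {T \<in> standard_tableaux S. T v = 1} = {}"
    by blast
  moreover have "finite (corners S)" by (rule finite_subset[OF _ assms(1)]) (auto simp: corners_def)
  ultimately have "card (standard_tableaux S)
      = (\<Sum>u\<in>corners S. card {T \<in> standard_tableaux S. T u = 1})"
    using finite_standard_tableaux[OF assms(1)]
    by (subst cover, intro card_UN_disjoint) auto
  then show ?thesis using card_standard_tableaux_one_at[OF assms(1)] by simp
qed

section \<open>Skew tableaux and shifted Schur functions\<close>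

text \<open>
  The truncated difference is harmless, because cells of the diagram have \<open>i \<ge> 1\<close>.
\<close>

definition skew_cells :: "nat list \<Rightarrow> (nat \<Rightarrow> nat) \<Rightarrow> cell set" where
  "skew_cells lam m = {(i, j) \<in> diagram lam. m (i - 1) < j}"

lemma skew_cells_eq_Sigma:
  "skew_cells lam m = (\<lambda>(k, j). (Suc k, j)) ` (SIGMA k:{..<length lam}. {m k<..part lam (Suc k)})"
proof (intro equalityI subsetI)
  fix u assume "u \<in> skew_cells lam m"
  then obtain i j where u: "u = (i, j)" "1 \<le> i" "i \<le> length lam" "m (i - 1) < j" "j \<le> part lam i"
    by (auto simp: skew_cells_def diagram_def)
  then show "u \<in> (\<lambda>(k, j). (Suc k, j)) ` (SIGMA k:{..<length lam}. {m k<..part lam (Suc k)})"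
    by (intro image_eqI[of _ _ "(i - 1, j)"]) auto
qed (auto simp: skew_cells_def diagram_def)

lemma finite_skew_cells: "finite (skew_cells lam m)"
  unfolding skew_cells_eq_Sigma by auto

lemma card_skew_cells:
  assumes "\<And>k. m k \<le> part lam (Suc k)"
  shows "real (card (skew_cells lam m)) = real (sum_list lam) - (\<Sum>k<length lam. real (m k))"
proof -
  have "card (skew_cells lam m) = (\<Sum>k<length lam. part lam (Suc k) - m k)"
    unfolding skew_cells_eq_Sigma by (subst card_image) (auto simp: inj_on_def)
  then have "real (card (skew_cells lam m)) = (\<Sum>k<length lam. real (part lam (Suc k))) - (\<Sum>k<length lam. real (m k))"
    by (simp add: of_nat_diff assms sum_subtractf)
  moreover have "sum_list lam = (\<Sum>k<length lam. part lam (Suc k))"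
    by (simp add: sum_list_sum_nth atLeast0LessThan part_def)
  ultimately show ?thesis by simp
qed

definition addable_rows :: "nat list \<Rightarrow> (nat \<Rightarrow> nat) \<Rightarrow> nat set" where
  "addable_rows lam m = {k. k < length lam \<and> m k < part lam (Suc k) \<and> antimono (m(k := Suc (m k)))}"

lemma corners_skew_cells:
  assumes lam: "is_partition lam" and m: "antimono m"
  shows "corners (skew_cells lam m) = (\<lambda>k. (Suc k, Suc (m k))) ` addable_rows lam m"
proof (intro equalityI subsetI)
  fix u assume u: "u \<in> corners (skew_cells lam m)"
  then obtain k j where k: "u = (Suc k, j)" "k < length lam" "m k < j" "j \<le> part lam (Suc k)"
    unfolding corners_def skew_cells_eq_Sigma by auto
  have "(Suc k, Suc (m k)) \<in> skew_cells lam m"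
    using k by (auto simp: skew_cells_def diagram_def)
  then have "j \<le> Suc (m k)" using u k(1) by (auto simp: corners_def)
  then have j: "j = Suc (m k)" using k(3) by simp
  have "(m(k := Suc (m k))) (Suc l) \<le> (m(k := Suc (m k))) l" for l
  proof (cases "k = Suc l")
    case True
    have "\<not> m l < j"
    proof
      assume "m l < j"
      moreover have "j \<le> part lam (Suc l)"
        using k(4) part_antimono[OF lam, of "Suc l" "Suc k"] True by simp
      ultimately have "(Suc l, j) \<in> skew_cells lam m"
        using k True by (auto simp: skew_cells_def diagram_def)
      then have "Suc k \<le> Suc l" using u k(1) unfolding corners_def by blast
      then show False using True by simp
    qed
    then show ?thesis using True j by simp
  next
    case False
    then show ?thesis using m by (auto simp: decseq_Suc_iff le_SucI)
  qed
  then have "antimono (m(k := Suc (m k)))" by (simp add: decseq_Suc_iff del: fun_upd_apply)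
  then show "u \<in> (\<lambda>k. (Suc k, Suc (m k))) ` addable_rows lam m"
    using k j by (auto simp: addable_rows_def)
next
  fix u assume "u \<in> (\<lambda>k. (Suc k, Suc (m k))) ` addable_rows lam m"
  then obtain k where k: "u = (Suc k, Suc (m k))" "k < length lam" "m k < part lam (Suc k)"
      "antimono (m(k := Suc (m k)))"
    by (auto simp: addable_rows_def)
  have "u \<in> skew_cells lam m" using k by (auto simp: skew_cells_def diagram_def)
  moreover have "Suc (m k) \<le> j'" if "(Suc k, j') \<in> skew_cells lam m" for j'
    using that by (auto simp: skew_cells_def)
  moreover have "Suc k \<le> i'" if i': "(i', Suc (m k)) \<in> skew_cells lam m" for i'
  proof (rule ccontr)
    assume "\<not> Suc k \<le> i'"
    then obtain l where l: "i' = Suc l" "l < k"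
      using i' by (cases i') (auto simp: skew_cells_def diagram_def)
    then have "m l < Suc (m k)" using i' by (auto simp: skew_cells_def)
    moreover have "(m(k := Suc (m k))) k \<le> (m(k := Suc (m k))) l"
      using l(2) by (intro decseqD[OF k(4)]) simp
    ultimately show False using l(2) by simp
  qed
  ultimately show "u \<in> corners (skew_cells lam m)" by (simp add: corners_def k(1))
qed

text \<open>
  Induction on the number of cells.  Removing the entry 1 on the one side and the Pieri rule on the other
  give the same recursion: in the Pieri rule a row whose box cannot be added, or whose box falls outside
  the partition, contributes zero.
\<close>

lemma card_standard_tableaux_shifted_schur:
  assumes lam: "is_partition lam"
    and "antimono m" "\<And>k. m k \<le> part lam (Suc k)"
  shows "real (card (standard_tableaux (skew_cells lam m))) * (\<Prod>u\<in>diagram lam. real_of_int (hook lam u))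
    = fact (card (skew_cells lam m)) * shifted_schur lam m"
  using assms(2,3)
proof (induction "card (skew_cells lam m)" arbitrary: m)
  case 0
  then have empty: "skew_cells lam m = {}" using finite_skew_cells by simp
  have "m k = part lam (Suc k)" for k
  proof (rule ccontr)
    assume "m k \<noteq> part lam (Suc k)"
    with 0(3)[of k] have "(Suc k, part lam (Suc k)) \<in> skew_cells lam m"
      by (auto simp: skew_cells_def diagram_def part_def split: if_splits)
    then show False by (simp add: empty)
  qed
  then have "m = (\<lambda>k. part lam (Suc k))" by auto
  moreover have "standard_tableaux {} = {\<lambda>_. undefined}"
    by (auto simp: standard_tableaux_def bij_betw_def)
  ultimately show ?case using shifted_schur_self[OF lam] empty by simp
next
  case (Suc N)
  let ?H = "\<Prod>u\<in>diagram lam. real_of_int (hook lam u)"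
  let ?S = "skew_cells lam m"
  have fin: "finite ?S" by (rule finite_skew_cells)
  have remove: "?S - {(Suc k, Suc (m k))} = skew_cells lam (m(k := Suc (m k)))" for k
  proof -
    have "m (i - 1) < j \<and> (i, j) \<noteq> (Suc k, Suc (m k)) \<longleftrightarrow> (m(k := Suc (m k))) (i - 1) < j"
      if "1 \<le> i" for i j using that by auto
    then show ?thesis unfolding skew_cells_def diagram_def by blast
  qed
  have IH: "real (card (standard_tableaux (?S - {(Suc k, Suc (m k))}))) * ?H
      = fact N * shifted_schur lam (m(k := Suc (m k)))" if k: "k \<in> addable_rows lam m" for k
  proof -
    have "(Suc k, Suc (m k)) \<in> ?S"
      using k by (auto simp: addable_rows_def skew_cells_def diagram_def)
    then have card: "N = card (skew_cells lam (m(k := Suc (m k))))"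
      unfolding remove[symmetric] using Suc(2) fin by simp
    have "(m(k := Suc (m k))) l \<le> part lam (Suc l)" for l
      using k Suc(4)[of l] by (auto simp: addable_rows_def)
    moreover have "antimono (m(k := Suc (m k)))" using k by (simp add: addable_rows_def del: fun_upd_apply)
    ultimately show ?thesis using Suc(1)[OF card] card remove by metis
  qed
  have zero: "shifted_schur lam (m(k := Suc (m k))) = 0" if "k < length lam" "k \<notin> addable_rows lam m" for k
  proof (cases "m k < part lam (Suc k)")
    case True
    with that have "\<not> antimono (m(k := Suc (m k)))" by (simp add: addable_rows_def del: fun_upd_apply)
    then show ?thesis by (rule shifted_schur_eq_0_if_not_antimono)
  next
    case False
    then show ?thesis by (intro shifted_schur_eq_0_if_not_contained[OF lam, of k]) auto
  qed
  have "?S \<noteq> {}" using Suc(2) by auto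
  then have "real (card (standard_tableaux ?S)) * ?H
      = (\<Sum>u\<in>corners ?S. real (card (standard_tableaux (?S - {u}))) * ?H)"
    using card_standard_tableaux_rec[OF fin] by (simp add: sum_distrib_right)
  also have "\<dots> = (\<Sum>k\<in>addable_rows lam m. real (card (standard_tableaux (?S - {(Suc k, Suc (m k))}))) * ?H)"
    unfolding corners_skew_cells[OF lam Suc(3)] by (subst sum.reindex) (auto simp: inj_on_def)
  also have "\<dots> = (\<Sum>k\<in>addable_rows lam m. fact N * shifted_schur lam (m(k := Suc (m k))))"
    by (intro sum.cong refl IH)
  also have "\<dots> = (\<Sum>k<length lam. fact N * shifted_schur lam (m(k := Suc (m k))))"
    using zero by (intro sum.mono_neutral_left) (auto simp: addable_rows_def simp del: fun_upd_apply)
  also have "\<dots> = fact N * (real (card ?S) * shifted_schur lam m)"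
    by (simp only: sum_distrib_left[symmetric] shifted_schur_pieri[OF Suc(3), symmetric]
        card_skew_cells[of m lam, OF Suc(4)])
  also have "\<dots> = fact (card ?S) * shifted_schur lam m"
    unfolding Suc(2)[symmetric] by (simp add: algebra_simps)
  finally show ?case .
qed

section \<open>Expansion over Gelfand--Tsetlin patterns\<close>

text \<open>
  Gelfand--Tsetlin patterns with top row \<open>m\<close>: row \<open>a\<close> is the shape formed by the entries exceeding \<open>a\<close> of a
  reverse tableau.  The last condition keeps all factors \<open>\<lambda>\<^bsub>T(u)\<^esub> - c(u)\<close> positive; geometrically, it keeps broken
  diagonals inside the shifted diagram.  It also forces row \<open>length lam\<close> to be empty.
\<close>

definition patterns :: "nat list \<Rightarrow> (nat \<Rightarrow> nat) \<Rightarrow> (nat \<Rightarrow> nat \<Rightarrow> nat) set" where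
  "patterns lam m = {\<nu>. \<nu> 0 = m \<and> (\<forall>a. \<nu> (Suc a) \<in> interlacing (\<nu> a))
     \<and> (\<forall>a k. \<nu> a k \<le> part lam (Suc a) + k)}"

definition pattern_weight :: "nat list \<Rightarrow> (nat \<Rightarrow> nat \<Rightarrow> nat) \<Rightarrow> real" where
  "pattern_weight lam \<nu> =
     (\<Prod>a<length lam. strip_weight (length lam - a) (lam ! a) (\<nu> a) (\<nu> (Suc a)))"

lemma patternsD:
  assumes "\<nu> \<in> patterns lam m"
  shows "\<nu> 0 = m" and "\<nu> a (Suc k) \<le> \<nu> (Suc a) k" and "\<nu> (Suc a) k \<le> \<nu> a k"
    and "\<nu> a k \<le> part lam (Suc a) + k"
  using assms by (auto simp: patterns_def interlacing_def)

lemma patterns_eq_0: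
  assumes "\<nu> \<in> patterns lam m" "length lam \<le> a + k"
  shows "\<nu> a k = 0"
  using assms(2)
proof (induction k arbitrary: a)
  case 0
  then show ?case using patternsD(4)[OF assms(1), of a 0] by (simp add: part_def)
next
  case (Suc k)
  then show ?case using patternsD(2)[OF assms(1), of a k] by simp
qed

lemma patterns_Nil: "patterns [] m = (if m = (\<lambda>_. 0) then {\<lambda>_ _. 0} else {})"
proof -
  have sub: "patterns [] m \<subseteq> {\<lambda>_ _. 0}"
    using patterns_eq_0[of _ "[]" m] by (auto simp: fun_eq_iff)
  have mem: "(\<lambda>_ _. 0) \<in> patterns [] m \<longleftrightarrow> m = (\<lambda>_. 0)"
    by (auto simp: patterns_def interlacing_def)
  show ?thesis
  proof (cases "(\<lambda>_ _. 0) \<in> patterns [] m")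
    case True
    then have "patterns [] m = {\<lambda>_ _. 0}" using sub by blast
    then show ?thesis using True mem by simp
  next
    case False
    then have "patterns [] m = {}" using sub by blast
    then show ?thesis using False mem by simp
  qed
qed

lemma patterns_Cons:
  assumes "\<And>k. m k \<le> x + k"
  shows "patterns (x # xs) m = case_nat m ` (\<Union>m'\<in>interlacing m. patterns xs m')"
proof (intro equalityI subsetI)
  fix \<nu> assume \<nu>: "\<nu> \<in> patterns (x # xs) m"
  then have "\<nu> = case_nat m (\<lambda>a. \<nu> (Suc a))" by (auto simp: patterns_def fun_eq_iff split: nat.splits)
  moreover have "\<nu> (Suc 0) \<in> interlacing m" using \<nu> by (auto simp: patterns_def)
  moreover have "\<nu> (Suc a) k \<le> part xs (Suc a) + k" for a k
    using patternsD(4)[OF \<nu>, of "Suc a" k] by simp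
  then have "(\<lambda>a. \<nu> (Suc a)) \<in> patterns xs (\<nu> (Suc 0))" using \<nu> by (auto simp: patterns_def)
  ultimately show "\<nu> \<in> case_nat m ` (\<Union>m'\<in>interlacing m. patterns xs m')" by blast
next
  fix \<nu> assume "\<nu> \<in> case_nat m ` (\<Union>m'\<in>interlacing m. patterns xs m')"
  then obtain m' \<nu>' where "\<nu> = case_nat m \<nu>'" "m' \<in> interlacing m" "\<nu>' \<in> patterns xs m'" by blast
  then show "\<nu> \<in> patterns (x # xs) m"
    using assms by (auto simp: patterns_def split: nat.splits)
qed

lemma patterns_empty:
  assumes "x + k < m k \<or> Suc (length xs) \<le> k \<and> 0 < m k"
  shows "patterns (x # xs) m = {}"
proof (rule ccontr)
  assume "patterns (x # xs) m \<noteq> {}"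
  then obtain \<nu> where \<nu>: "\<nu> \<in> patterns (x # xs) m" by blast
  show False
    using assms patternsD(1)[OF \<nu>] patternsD(4)[OF \<nu>, of 0 k] patterns_eq_0[OF \<nu>, of 0 k] by auto
qed

lemma finite_patterns: "finite (patterns lam m)"
proof (induction lam arbitrary: m)
  case Nil
  then show ?case by (simp add: patterns_Nil)
next
  case (Cons x xs)
  show ?case
  proof (cases "(\<forall>k. m k \<le> x + k) \<and> (\<forall>k\<ge>Suc (length xs). m k = 0)")
    case True
    then show ?thesis using Cons.IH finite_interlacing[of "Suc (length xs)" m] by (simp add: patterns_Cons)
  next
    case False
    then obtain k where "x + k < m k \<or> Suc (length xs) \<le> k \<and> 0 < m k" by (auto simp: not_le)
    then show ?thesis using patterns_empty[of x k m xs] by simp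
  qed
qed

lemma pattern_weight_Cons:
  "pattern_weight (x # xs) (case_nat m \<nu>)
    = strip_weight (Suc (length xs)) x m (\<nu> 0) * pattern_weight xs \<nu>"
  unfolding pattern_weight_def by (simp add: prod.lessThan_Suc_shift del: prod.lessThan_Suc)

text \<open>
  Unfolding the branching rule gives all patterns; those violating the bound by the partition are dropped
  because the remaining factor vanishes.
\<close>

lemma shifted_schur_eq_sum_patterns:
  assumes "is_partition lam"
  shows "shifted_schur lam m = (\<Sum>\<nu>\<in>patterns lam m. pattern_weight lam \<nu>)"
  using assms
proof (induction lam arbitrary: m)
  case Nil
  then show ?case by (simp add: patterns_Nil pattern_weight_def)
next
  case (Cons x xs)
  show ?case
  proof (cases "(\<forall>k. m k \<le> x + k) \<and> (\<forall>k\<ge>Suc (length xs). m k = 0)")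
    case True
    then have fin: "finite (interlacing m)" using finite_interlacing[of "Suc (length xs)" m] by blast
    have inj: "inj_on (case_nat m) A" for A :: "(nat \<Rightarrow> nat \<Rightarrow> nat) set"
    proof (rule inj_onI)
      fix f g :: "nat \<Rightarrow> nat \<Rightarrow> nat" assume "case_nat m f = case_nat m g"
      then have "case_nat m f (Suc a) = case_nat m g (Suc a)" for a by simp
      then show "f = g" by (auto simp: fun_eq_iff)
    qed
    have "(\<Sum>\<nu>\<in>patterns (x # xs) m. pattern_weight (x # xs) \<nu>)
       = (\<Sum>\<nu>\<in>(\<Union>m'\<in>interlacing m. patterns xs m'). strip_weight (Suc (length xs)) x m (\<nu> 0) * pattern_weight xs \<nu>)"
      using True by (simp add: patterns_Cons sum.reindex[OF inj] pattern_weight_Cons)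
    also have "\<dots> = (\<Sum>m'\<in>interlacing m. \<Sum>\<nu>\<in>patterns xs m'. strip_weight (Suc (length xs)) x m (\<nu> 0) * pattern_weight xs \<nu>)"
      using fin finite_patterns by (intro sum.UNION_disjoint) (auto simp: patterns_def)
    also have "\<dots> = (\<Sum>m'\<in>interlacing m. strip_weight (Suc (length xs)) x m m' * shifted_schur xs m')"
      using Cons by (intro sum.cong refl) (simp add: is_partition_Cons sum_distrib_left patternsD(1))
    finally show ?thesis by simp
  next
    case False
    then obtain k where k: "x + k < m k \<or> Suc (length xs) \<le> k \<and> 0 < m k"
      by (auto simp: not_le)
    have "shifted_schur (x # xs) m = 0"
      using k shifted_schur_eq_0_if_exceeds_bound[of "x # xs" x k m]
        shifted_schur_eq_0_if_too_long[of "x # xs" k m] Cons.prems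
      by (auto simp: is_partition_Cons simp del: shifted_schur.simps)
    then show ?thesis using patterns_empty[of x k m xs] k by simp
  qed
qed

section \<open>Reverse excited moves as increments of patterns\<close>

lemma patterns_antimono:
  assumes "\<nu> \<in> patterns lam m"
  shows "antimono (\<nu> a)"
  using assms by (intro interlacing_antimono(1)[of "\<nu> (Suc a)"]) (auto simp: patterns_def)

lemma patterns_le_first:
  assumes "\<nu> \<in> patterns lam m"
  shows "\<nu> a k \<le> m 0"
proof -
  have "\<nu> a k \<le> \<nu> 0 k"
    by (induction a) (auto intro: order_trans[OF patternsD(3)[OF assms]])
  also have "\<dots> \<le> \<nu> 0 0" using patterns_antimono[OF assms, of 0] by (simp add: decseqD)
  finally show ?thesis using patternsD(1)[OF assms] by simp
qed

text \<open>
  In row \<open>a + 1\<close> of the shifted diagram with \<open>d\<close> rows, the index \<open>k\<close> of the pattern stands for the interval of columns from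
  \<open>d + \<nu> (a + 1) k - k - 1\<close> to \<open>d + \<nu> a k - k - 1\<close>.  Its first cell belongs neither to the reverse excited diagram
  nor to a broken diagonal; the other ones are the cells of broken diagonals.
\<close>

definition covers :: "nat \<Rightarrow> (nat \<Rightarrow> nat \<Rightarrow> nat) \<Rightarrow> nat \<Rightarrow> nat \<Rightarrow> nat \<Rightarrow> bool" where
  "covers d \<nu> a j k \<longleftrightarrow> d + \<nu> (Suc a) k \<le> j + k + 1 \<and> j + k + 1 \<le> d + \<nu> a k"

definition pattern_diagram :: "nat list \<Rightarrow> (nat \<Rightarrow> nat \<Rightarrow> nat) \<Rightarrow> cell set" where
  "pattern_diagram lam \<nu> = {(i, j) \<in> shifted_diagram (length lam) lam.
     \<not> (\<exists>k. covers (length lam) \<nu> (i - 1) j k)}"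

lemma pattern_diagram_iff:
  "(Suc a, j) \<in> pattern_diagram lam \<nu> \<longleftrightarrow>
     (Suc a, j) \<in> shifted_diagram (length lam) lam \<and> \<not> (\<exists>k. covers (length lam) \<nu> a j k)"
  by (simp add: pattern_diagram_def)

text \<open>
  The cell \<open>(k + 1, r)\<close> of the reverse tableau with entry \<open>i\<close> and content \<open>c\<close> becomes the cell \<open>(i, c + d)\<close>.  The \<open>r\<close>-th
  broken diagonal thus records column \<open>r\<close> of the tableau.
\<close>

definition pattern_diagonals :: "nat \<Rightarrow> (nat \<Rightarrow> nat \<Rightarrow> nat) \<Rightarrow> nat \<Rightarrow> cell set" where
  "pattern_diagonals d \<nu> r =
     {(i, j). 1 \<le> i \<and> (\<exists>k. j + k + 1 = d + r \<and> \<nu> i k < r \<and> r \<le> \<nu> (i - 1) k)}"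

text \<open>
  Interlacing makes the intervals of different indices \<open>k\<close> in one row disjoint.
\<close>

lemma covers_unique:
  assumes "\<nu> \<in> patterns lam m" "covers d \<nu> a j k" "covers d \<nu> a j k'"
  shows "k = k'"
proof -
  have *: False if kl: "k < l" "covers d \<nu> a j k" "covers d \<nu> a j l" for k l
  proof -
    obtain l' where l: "l = Suc l'" "k \<le> l'" using kl(1) by (cases l) auto
    have "\<nu> a l \<le> \<nu> (Suc a) l'" using patternsD(2)[OF assms(1)] l by simp
    also have "\<dots> \<le> \<nu> (Suc a) k" using patterns_antimono[OF assms(1)] l(2) by (simp add: decseqD)
    finally show False using kl by (auto simp: covers_def)
  qed
  then show ?thesis using assms(2,3) by (metis linorder_neqE_nat)
qed

definition increment :: "(nat \<Rightarrow> nat \<Rightarrow> nat) \<Rightarrow> nat \<Rightarrow> nat \<Rightarrow> nat \<Rightarrow> nat \<Rightarrow> nat" where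
  "increment \<nu> a k = \<nu>(a := (\<nu> a)(k := Suc (\<nu> a k)))"

lemma increment_apply: "increment \<nu> a k b l = (if b = a \<and> l = k then Suc (\<nu> a k) else \<nu> b l)"
  by (simp add: increment_def)

lemma patternsI:
  assumes "\<nu> 0 = m" "\<And>a k. \<nu> a (Suc k) \<le> \<nu> (Suc a) k" "\<And>a k. \<nu> (Suc a) k \<le> \<nu> a k"
    "\<And>a k. \<nu> a k \<le> part lam (Suc a) + k"
  shows "\<nu> \<in> patterns lam m"
  using assms by (auto simp: patterns_def interlacing_def)

lemma increment_in_patterns:
  assumes \<nu>: "\<nu> \<in> patterns lam m"
    and "Suc (\<nu> (Suc a) k) \<le> \<nu> a k"
    and "\<And>l. k = Suc l \<Longrightarrow> Suc (\<nu> (Suc a) k) \<le> \<nu> (Suc (Suc a)) l"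
    and "Suc (\<nu> (Suc a) k) \<le> part lam (Suc (Suc a)) + k"
  shows "increment \<nu> (Suc a) k \<in> patterns lam m"
proof (rule patternsI)
  show "increment \<nu> (Suc a) k 0 = m" using patternsD(1)[OF \<nu>] by (simp add: increment_def)
  fix b l
  show "increment \<nu> (Suc a) k b (Suc l) \<le> increment \<nu> (Suc a) k (Suc b) l"
    using patternsD(2)[OF \<nu>, of b l] assms(3)[of l] by (auto simp: increment_apply)
  show "increment \<nu> (Suc a) k (Suc b) l \<le> increment \<nu> (Suc a) k b l"
    using patternsD(3)[OF \<nu>, of b l] assms(2) by (auto simp: increment_apply)
  show "increment \<nu> (Suc a) k b l \<le> part lam (Suc b) + l"
    using patternsD(4)[OF \<nu>, of b l] assms(4) by (auto simp: increment_apply)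
qed

text \<open>
  Increasing \<open>\<nu> (a + 1) k\<close> moves the left end of interval \<open>k\<close> in row \<open>a + 1\<close> from column \<open>j - 1\<close> to \<open>j\<close>, and
  the right end of interval \<open>k\<close> in row \<open>a + 2\<close> from \<open>j - 1\<close> to \<open>j\<close>.  Disjointness of the intervals, for the old
  and for the new pattern, turns this into a statement about the union of the intervals.
\<close>

lemma covers_increment:
  assumes \<nu>: "\<nu> \<in> patterns lam m" and \<nu>': "increment \<nu> (Suc a) k \<in> patterns lam m"
    and j: "j + k = d + \<nu> (Suc a) k" "1 \<le> j"
  shows "(\<exists>l. covers d (increment \<nu> (Suc a) k) a j' l) \<longleftrightarrow> (\<exists>l. covers d \<nu> a j' l) \<and> j' \<noteq> j - 1"
    and "(\<exists>l. covers d (increment \<nu> (Suc a) k) (Suc a) j' l) \<longleftrightarrow> (\<exists>l. covers d \<nu> (Suc a) j' l) \<or> j' = j"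
    and "b \<noteq> a \<Longrightarrow> b \<noteq> Suc a \<Longrightarrow> covers d (increment \<nu> (Suc a) k) b j' l \<longleftrightarrow> covers d \<nu> b j' l"
    and "covers d \<nu> a (j - 1) k" and "covers d \<nu> a j k" and "covers d \<nu> (Suc a) (j - 1) k"
    and "\<not> covers d \<nu> (Suc a) j l"
proof -
  let ?\<nu>' = "increment \<nu> (Suc a) k"
  have up: "Suc (\<nu> (Suc a) k) \<le> \<nu> a k"
    using patternsD(3)[OF \<nu>', of a k] by (simp add: increment_apply)
  have low: "\<nu> (Suc (Suc a)) k \<le> \<nu> (Suc a) k" using patternsD(3)[OF \<nu>] .
  show c1: "covers d \<nu> a (j - 1) k" and c2: "covers d \<nu> a j k" and "covers d \<nu> (Suc a) (j - 1) k"
    using j up low by (auto simp: covers_def)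
  have row1: "covers d ?\<nu>' a j' l \<longleftrightarrow> covers d \<nu> a j' l \<and> (l = k \<longrightarrow> j' \<noteq> j - 1)" for j' l
    using j by (auto simp: covers_def increment_apply)
  have row2: "covers d ?\<nu>' (Suc a) j' l \<longleftrightarrow> covers d \<nu> (Suc a) j' l \<or> (l = k \<and> j' = j)" for j' l
    using j low by (auto simp: covers_def increment_apply)
  show "(\<exists>l. covers d ?\<nu>' a j' l) \<longleftrightarrow> (\<exists>l. covers d \<nu> a j' l) \<and> j' \<noteq> j - 1"
    using row1 covers_unique[OF \<nu> c1] by metis
  show "(\<exists>l. covers d ?\<nu>' (Suc a) j' l) \<longleftrightarrow> (\<exists>l. covers d \<nu> (Suc a) j' l) \<or> j' = j"
    using row2 by metis
  show "b \<noteq> a \<Longrightarrow> b \<noteq> Suc a \<Longrightarrow> covers d ?\<nu>' b j' l \<longleftrightarrow> covers d \<nu> b j' l"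
    by (simp add: covers_def increment_apply)
  show "\<not> covers d \<nu> (Suc a) j l"
  proof
    assume c: "covers d \<nu> (Suc a) j l"
    then have "covers d ?\<nu>' (Suc a) j l" "covers d ?\<nu>' (Suc a) j k" using row2 by auto
    then have "l = k" by (rule covers_unique[OF \<nu>'])
    then show False using c j by (auto simp: covers_def)
  qed
qed

text \<open>
  In the tableau, one entry of column \<open>\<nu> (a + 1) k + 1\<close> changes from \<open>a + 1\<close> to \<open>a + 2\<close>.
\<close>

lemma pattern_diagonals_increment:
  assumes "\<nu> \<in> patterns lam m" and "increment \<nu> (Suc a) k \<in> patterns lam m"
    and j: "j + k = d + \<nu> (Suc a) k"
  shows "pattern_diagonals d (increment \<nu> (Suc a) k) =
    (pattern_diagonals d \<nu>)(Suc (\<nu> (Suc a) k) :=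
       pattern_diagonals d \<nu> (Suc (\<nu> (Suc a) k)) - {(Suc a, j)} \<union> {(Suc (Suc a), j)})"
    (is "_ = (pattern_diagonals d \<nu>)(?t := ?X)")
proof
  fix r
  let ?\<nu>' = "increment \<nu> (Suc a) k"
  have up: "Suc (\<nu> (Suc a) k) \<le> \<nu> a k"
    using patternsD(3)[OF assms(2), of a k] by (simp add: increment_apply)
  have low: "\<nu> (Suc (Suc a)) k \<le> \<nu> (Suc a) k" using patternsD(3)[OF assms(1)] .
  have eq: "(j' + l + 1 = d + r \<and> ?\<nu>' (Suc b) l < r \<and> r \<le> ?\<nu>' b l) \<longleftrightarrow>
    (j' + l + 1 = d + r \<and> \<nu> (Suc b) l < r \<and> r \<le> \<nu> b l) \<and> \<not> (r = ?t \<and> b = a \<and> j' = j)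
      \<or> (r = ?t \<and> b = Suc a \<and> j' = j \<and> l = k)" for b j' l
  proof -
    have "r = ?t \<Longrightarrow> j' + l + 1 = d + r \<Longrightarrow> j' = j \<longleftrightarrow> l = k" using j by auto
    then show ?thesis using up low j by (auto simp: increment_apply)
  qed
  have "(Suc b, j') \<in> pattern_diagonals d ?\<nu>' r \<longleftrightarrow>
     (Suc b, j') \<in> pattern_diagonals d \<nu> r \<and> \<not> (r = ?t \<and> b = a \<and> j' = j) \<or> (r = ?t \<and> b = Suc a \<and> j' = j)"
    for b j'
    using eq[of j' _ b] by (auto simp: pattern_diagonals_def)
  moreover have "(0, j') \<notin> pattern_diagonals d \<mu> r" for \<mu> j' by (simp add: pattern_diagonals_def)
  ultimately have "(i, j') \<in> pattern_diagonals d ?\<nu>' r \<longleftrightarrow>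
     (i, j') \<in> ((pattern_diagonals d \<nu>)(?t := ?X)) r" for i j'
    by (cases i) auto
  then show "pattern_diagonals d ?\<nu>' r = ((pattern_diagonals d \<nu>)(?t := ?X)) r" by auto
qed

lemma increment_is_move:
  assumes lam: "is_partition lam"
    and \<nu>: "\<nu> \<in> patterns lam m" and \<nu>': "increment \<nu> (Suc a) k \<in> patterns lam m"
    and j: "j + k = length lam + \<nu> (Suc a) k"
  shows "reverse_excited_move lam (Suc (Suc a)) j (pattern_diagram lam \<nu>)
           (pattern_diagram lam (increment \<nu> (Suc a) k))"
    and "(Suc a, j) \<in> pattern_diagonals (length lam) \<nu> (Suc (\<nu> (Suc a) k))"
    and "Suc (\<nu> (Suc a) k) \<in> {1..m 0}"
proof -
  let ?\<nu>' = "increment \<nu> (Suc a) k" and ?d = "length lam"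
  have v: "?\<nu>' (Suc a) k = Suc (\<nu> (Suc a) k)" by (simp add: increment_apply)
  have ak: "Suc a + k < ?d"
    by (rule ccontr) (use patterns_eq_0[OF \<nu>', of "Suc a" k] v in simp)
  have jge: "Suc (Suc a) \<le> j" using j ak by simp
  have jlt: "j < part lam (Suc (Suc a)) + ?d"
    using patternsD(4)[OF \<nu>', of "Suc a" k] v j by simp
  have jlt': "j < part lam (Suc a) + ?d"
    using jlt part_antimono[OF lam, of "Suc a" "Suc (Suc a)"] by simp
  have in1: "(Suc (Suc a), j) \<in> shifted_diagram ?d lam" and in2: "(Suc a, j) \<in> shifted_diagram ?d lam"
    and in3: "(Suc a, j - 1) \<in> shifted_diagram ?d lam"
    using jge jlt jlt' ak by (auto simp: shifted_diagram_def)
  have j1: "1 \<le> j" using jge by simp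
  note c = covers_increment[OF \<nu> \<nu>' j j1]
  have "(i, j') \<in> pattern_diagram lam ?\<nu>' \<longleftrightarrow>
      (i, j') \<in> pattern_diagram lam \<nu> - {(Suc (Suc a), j)} \<union> {(Suc a, j - 1)}" for i j'
  proof (cases i)
    case 0
    then show ?thesis by (simp add: pattern_diagram_def shifted_diagram_def)
  next
    case (Suc b)
    consider "b = a" | "b = Suc a" | "b \<noteq> a" "b \<noteq> Suc a" by blast
    then show ?thesis
    proof cases
      case 1
      show ?thesis unfolding Suc 1 Un_iff Diff_iff pattern_diagram_iff c(1) using in3 by auto
    next
      case 2
      show ?thesis unfolding Suc 2 Un_iff Diff_iff pattern_diagram_iff c(2) by auto
    next
      case 3
      show ?thesis unfolding Suc Un_iff Diff_iff pattern_diagram_iff c(3)[OF 3] using 3 by auto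
    qed
  qed
  then have D': "pattern_diagram lam ?\<nu>'
      = pattern_diagram lam \<nu> - {(Suc (Suc a), j)} \<union> {(Suc a, j - 1)}" by auto
  show "reverse_excited_move lam (Suc (Suc a)) j (pattern_diagram lam \<nu>) (pattern_diagram lam ?\<nu>')"
    unfolding reverse_excited_move_def
    using in1 in2 in3 c(4,5,6) c(7) D' by (auto simp: pattern_diagram_def)
  have up: "Suc (\<nu> (Suc a) k) \<le> \<nu> a k"
    using patternsD(3)[OF \<nu>', of a k] by (simp add: increment_apply)
  then show "(Suc a, j) \<in> pattern_diagonals ?d \<nu> (Suc (\<nu> (Suc a) k))"
    using j by (auto simp: pattern_diagonals_def intro!: exI[of _ k])
  show "Suc (\<nu> (Suc a) k) \<in> {1..m 0}" using patterns_le_first[OF \<nu>', of "Suc a" k] v by simp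
qed

text \<open>
  The cell \<open>(i, j)\<close> is free while its left, upper and upper left neighbours are covered.  Hence some interval
  of row \<open>i\<close> ends at column \<open>j - 1\<close>, so the interval of row \<open>i - 1\<close> with the same index starts there.  The
  interval of row \<open>i - 1\<close> through column \<open>j\<close> contains \<open>j - 1\<close> as well, so by disjointness it is the same one, and
  the entry at which it starts can be increased.
\<close>

lemma move_is_increment:
  assumes lam: "is_partition lam" and \<nu>: "\<nu> \<in> patterns lam m"
    and move: "reverse_excited_move lam i j (pattern_diagram lam \<nu>) D'"
  obtains a k where "i = Suc (Suc a)" "j + k = length lam + \<nu> (Suc a) k"
    "increment \<nu> (Suc a) k \<in> patterns lam m"
proof -
  let ?d = "length lam"
  have mem: "(i, j) \<in> pattern_diagram lam \<nu>" "(i - 1, j - 1) \<in> shifted_diagram ?d lam"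
      "(i - 1, j) \<in> shifted_diagram ?d lam" "(i - 1, j) \<notin> pattern_diagram lam \<nu>"
      "(i, j - 1) \<notin> pattern_diagram lam \<nu>"
    using move by (auto simp: reverse_excited_move_def)
  obtain a where i: "i = Suc (Suc a)"
    using mem(2) by (cases i; cases "i - 1") (auto simp: shifted_diagram_def)
  have inl: "Suc (Suc a) \<le> ?d" "Suc (Suc a) \<le> j" "j < part lam (Suc (Suc a)) + ?d"
    using mem(1) i by (auto simp: pattern_diagram_def shifted_diagram_def)
  have nocov: "\<not> covers ?d \<nu> (Suc a) j l" for l
    using mem(1) i by (auto simp: pattern_diagram_def)
  obtain k where k: "covers ?d \<nu> a j k"
    using mem(3,4) i by (auto simp: pattern_diagram_def)
  \<comment> \<open>If column \<open>j - 1\<close> lies just left of the shifted diagram, it starts the interval of index \<open>length lam - a - 2\<close>, where \<open>\<nu> (a + 2)\<close> is zero.\<close>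
  obtain l where l: "covers ?d \<nu> (Suc a) (j - 1) l"
  proof (cases "(i, j - 1) \<in> shifted_diagram ?d lam")
    case True
    then show ?thesis using mem(5) i that by (auto simp: pattern_diagram_def)
  next
    case False
    then have "j = Suc (Suc a)" using inl i by (auto simp: shifted_diagram_def)
    moreover obtain n where n: "?d = Suc (Suc a) + n" using inl(1) le_Suc_ex by blast
    ultimately have "covers ?d \<nu> (Suc a) (j - 1) n"
      using patterns_eq_0[OF \<nu>, of "Suc (Suc a)" n] by (simp add: covers_def)
    then show ?thesis by (rule that)
  qed
  have jl: "j + l = ?d + \<nu> (Suc a) l"
    using l nocov[of l] inl(2) by (auto simp: covers_def)
  have lt: "?d + \<nu> (Suc a) k < j + k + 1"
  proof (rule ccontr)
    assume "\<not> ?thesis"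
    then have "covers ?d \<nu> (Suc a) j k"
      using k patternsD(3)[OF \<nu>, of "Suc a" k] by (simp add: covers_def)
    then show False using nocov by blast
  qed
  have "covers ?d \<nu> a (j - 1) k" using k lt inl(2) by (auto simp: covers_def)
  moreover have "covers ?d \<nu> a (j - 1) l"
    using jl inl(2) patternsD(3)[OF \<nu>, of a l] by (auto simp: covers_def)
  ultimately have kl: "k = l" by (rule covers_unique[OF \<nu>])
  have "increment \<nu> (Suc a) k \<in> patterns lam m"
  proof (rule increment_in_patterns[OF \<nu>])
    show "Suc (\<nu> (Suc a) k) \<le> \<nu> a k" using k jl kl by (auto simp: covers_def)
    show "Suc (\<nu> (Suc a) k) \<le> part lam (Suc (Suc a)) + k" using inl(3) jl kl by simp
    fix k' assume k': "k = Suc k'"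
    have "\<nu> (Suc a) k \<le> \<nu> (Suc (Suc a)) k'" using patternsD(2)[OF \<nu>] k' by simp
    moreover have "\<nu> (Suc (Suc a)) k' \<noteq> \<nu> (Suc a) k"
      using nocov[of k'] jl kl k' patternsD(3)[OF \<nu>, of "Suc a" k'] by (auto simp: covers_def)
    ultimately show "Suc (\<nu> (Suc a) k) \<le> \<nu> (Suc (Suc a)) k'" by simp
  qed
  then show ?thesis using that[of a k] i jl kl by simp
qed

lemma pattern_diagonals_disjoint:
  assumes "\<nu> \<in> patterns lam m" "(Suc a, j) \<in> pattern_diagonals d \<nu> r" "(Suc a, j) \<in> pattern_diagonals d \<nu> s"
  shows "r = s"
proof -
  obtain k l where k: "j + k + 1 = d + r" "\<nu> (Suc a) k < r" "r \<le> \<nu> a k"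
    and l: "j + l + 1 = d + s" "\<nu> (Suc a) l < s" "s \<le> \<nu> a l"
    using assms(2,3) by (auto simp: pattern_diagonals_def)
  have "k = l" using k l by (intro covers_unique[OF assms(1), of d a j]) (auto simp: covers_def)
  then show ?thesis using k l by simp
qed

text \<open>
  Going down the rows, the right ends of the intervals in row \<open>a + 1\<close> are known from the row \<open>\<nu> a\<close> of the pattern.
  If the left end of an interval were further right in one pattern than in the other, the left end of the
  longer interval would be free in the first pattern.
\<close>

lemma pattern_diagram_inj: "inj_on (pattern_diagram lam) (patterns lam m)"
proof -
  let ?d = "length lam"
  have le: "\<nu>' (Suc a) k \<le> \<nu> (Suc a) k"
    if \<nu>: "\<nu> \<in> patterns lam m" and \<nu>': "\<nu>' \<in> patterns lam m"
      and eq: "pattern_diagram lam \<nu> = pattern_diagram lam \<nu>'" and a: "\<nu> a = \<nu>' a" for \<nu> \<nu>' a k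
  proof (rule ccontr)
    assume "\<not> ?thesis"
    then have lt: "\<nu> (Suc a) k < \<nu>' (Suc a) k" by simp
    have ak: "Suc a + k < ?d"
      by (rule ccontr) (use patterns_eq_0[OF \<nu>', of "Suc a" k] lt in simp)
    define j where "j = ?d + \<nu> (Suc a) k - k - 1"
    have j: "j + k + 1 = ?d + \<nu> (Suc a) k" using ak by (simp add: j_def)
    have less: "\<nu> (Suc a) k < \<nu> a k" using lt patternsD(3)[OF \<nu>', of a k] a by simp
    then have "covers ?d \<nu> a j k" using j by (simp add: covers_def)
    then have "(Suc a, j) \<notin> pattern_diagram lam \<nu>" by (auto simp: pattern_diagram_def)
    moreover have "(Suc a, j) \<in> shifted_diagram ?d lam"
      using j ak less patternsD(4)[OF \<nu>, of a k] by (auto simp: shifted_diagram_def)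
    ultimately obtain l where l: "covers ?d \<nu>' a j l"
      unfolding eq pattern_diagram_iff by blast
    have "l \<noteq> k" using l lt j by (auto simp: covers_def)
    moreover have "\<not> l < k"
      using l lt j decseqD[OF patterns_antimono[OF \<nu>'], of l k "Suc a"] by (auto simp: covers_def)
    moreover have "\<not> k < l"
    proof
      assume "k < l"
      then obtain l' where l': "l = Suc l'" "k \<le> l'" by (cases l) auto
      have "\<nu> a l \<le> \<nu> (Suc a) l'" using patternsD(2)[OF \<nu>] l' by simp
      also have "\<dots> \<le> \<nu> (Suc a) k" using decseqD[OF patterns_antimono[OF \<nu>] l'(2)] .
      finally show False using l j a \<open>k < l\<close> by (auto simp: covers_def)
    qed
    ultimately show False by simp
  qed
  show ?thesis
  proof (rule inj_onI)
    fix \<nu> \<nu>' assume *: "\<nu> \<in> patterns lam m" "\<nu>' \<in> patterns lam m"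
      "pattern_diagram lam \<nu> = pattern_diagram lam \<nu>'"
    have "\<nu> a = \<nu>' a" for a
    proof (induction a)
      case 0
      then show ?case using *(1,2) by (simp add: patternsD(1))
    next
      case (Suc a)
      then show ?case using le[OF *] le[OF *(2,1) *(3)[symmetric]] by (intro ext antisym) auto
    qed
    then show "\<nu> = \<nu>'" by auto
  qed
qed

section \<open>Reverse excited diagrams and broken diagonals\<close>

text \<open>
  The reverse tableau in which every column, read upwards, is \<open>1, 2, 3, \<dots>\<close>.
\<close>

definition lowest_pattern :: "nat list \<Rightarrow> nat \<Rightarrow> nat \<Rightarrow> nat" where
  "lowest_pattern mu a k = part mu (Suc (a + k))"

lemma part_mono_diagram:
  assumes "diagram mu \<subseteq> diagram lam" "1 \<le> i"
  shows "part mu i \<le> part lam i"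
proof (cases "part mu i = 0")
  case False
  then have "(i, part mu i) \<in> diagram mu"
    using assms(2) by (auto simp: diagram_def part_def split: if_splits)
  then show ?thesis using assms(1) by (auto simp: diagram_def)
qed simp

lemma part_pos_le_length: "0 < part mu i \<Longrightarrow> i \<le> length mu"
  by (auto simp: part_def split: if_splits)

lemma lowest_pattern_in_patterns:
  assumes mu: "is_partition mu" and sub: "diagram mu \<subseteq> diagram lam"
  shows "lowest_pattern mu \<in> patterns lam (\<lambda>k. part mu (Suc k))"
proof (rule patternsI)
  show "lowest_pattern mu 0 = (\<lambda>k. part mu (Suc k))" by (auto simp: lowest_pattern_def)
  fix a k
  show "lowest_pattern mu a (Suc k) \<le> lowest_pattern mu (Suc a) k"
    by (simp add: lowest_pattern_def)
  show "lowest_pattern mu (Suc a) k \<le> lowest_pattern mu a k"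
    using part_antimono[OF mu] by (simp add: lowest_pattern_def)
  show "lowest_pattern mu a k \<le> part lam (Suc a) + k"
    using part_antimono[OF mu, of "Suc a" "Suc (a + k)"] part_mono_diagram[OF sub, of "Suc a"]
    by (simp add: lowest_pattern_def)
qed

text \<open>
  For this pattern the intervals in each row are adjacent, so their union is an initial part of the row.
\<close>

lemma pattern_diagram_lowest:
  assumes mu: "is_partition mu"
  shows "pattern_diagram lam (lowest_pattern mu) = shifted_skew lam mu"
proof -
  let ?d = "length lam"
  have cov: "(\<exists>k. covers ?d (lowest_pattern mu) a j k) \<longleftrightarrow> j < part mu (Suc a) + ?d"
    if "a < ?d" for a j
  proof
    assume "\<exists>k. covers ?d (lowest_pattern mu) a j k"
    then obtain k where "j + k + 1 \<le> ?d + part mu (Suc (a + k))"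
      by (auto simp: covers_def lowest_pattern_def)
    then show "j < part mu (Suc a) + ?d"
      using part_antimono[OF mu, of "Suc a" "Suc (a + k)"] by simp
  next
    assume j: "j < part mu (Suc a) + ?d"
    let ?P = "\<lambda>k. j + k + 1 \<le> ?d + part mu (Suc (a + k))"
    have bound: "k \<le> ?d + part mu (Suc a)" if "?P k" for k
      using that part_antimono[OF mu, of "Suc a" "Suc (a + k)"] by simp
    define k where "k = Greatest ?P"
    have "?P 0" using j by simp
    then have k: "?P k" unfolding k_def by (rule GreatestI_nat) (use bound in blast)
    have "\<not> ?P (Suc k)"
      using Greatest_le_nat[of ?P "Suc k" "?d + part mu (Suc a)"] bound unfolding k_def[symmetric] by fastforce
    then show "\<exists>k. covers ?d (lowest_pattern mu) a j k"
      using k by (intro exI[of _ k]) (simp add: covers_def lowest_pattern_def)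
  qed
  have "(i, j) \<in> pattern_diagram lam (lowest_pattern mu) \<longleftrightarrow> (i, j) \<in> shifted_skew lam mu" for i j
  proof (cases i)
    case 0
    then show ?thesis by (simp add: pattern_diagram_def shifted_skew_def shifted_diagram_def)
  next
    case (Suc a)
    show ?thesis
    proof (cases "a < ?d")
      case True
      show ?thesis
        unfolding Suc pattern_diagram_iff cov[OF True] by (auto simp: shifted_skew_def shifted_diagram_def)
    qed (simp add: Suc pattern_diagram_iff shifted_skew_def shifted_diagram_def)
  qed
  then show ?thesis by auto
qed

lemma pattern_diagonals_lowest:
  assumes mu: "is_partition mu" and sub: "diagram mu \<subseteq> diagram lam"
  shows "pattern_diagonals (length lam) (lowest_pattern mu) = initial_broken_diagonals lam mu"
proof
  fix r
  let ?d = "length lam"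
  have lenmu: "i \<le> ?d" if "0 < part mu i" "1 \<le> i" for i
    using that part_mono_diagram[OF sub, of i] part_pos_le_length[of lam i] by simp
  show "pattern_diagonals ?d (lowest_pattern mu) r = initial_broken_diagonals lam mu r"
  proof (cases "1 \<le> r \<and> r \<le> part mu 1")
    case False
    have "\<not> (\<nu> < r \<and> r \<le> part mu (Suc (i - 1 + k)))" for \<nu> i k
      using False part_antimono[OF mu, of 1 "Suc (i - 1 + k)"] by auto
    then show ?thesis using False
      by (auto simp: pattern_diagonals_def lowest_pattern_def initial_broken_diagonals_def)
  next
    case True
    let ?c = "conj_part mu r"
    have gal: "i \<le> ?c \<longleftrightarrow> r \<le> part mu i" if "1 \<le> i" for i
      using conj_part_galois[OF mu that] True by simp
    have c1: "1 \<le> ?c" using gal[of 1] True by simp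
    have cd: "?c \<le> ?d" using gal[OF c1] True lenmu[OF _ c1] by simp
    have "(i, j) \<in> pattern_diagonals ?d (lowest_pattern mu) r \<longleftrightarrow> (i, j) \<in> initial_broken_diagonals lam mu r"
      for i j
    proof
      assume "(i, j) \<in> pattern_diagonals ?d (lowest_pattern mu) r"
      then obtain k where i: "1 \<le> i" and k: "j + k + 1 = ?d + r" "part mu (Suc (i + k)) < r"
          "r \<le> part mu (i + k)"
        by (auto simp: pattern_diagonals_def lowest_pattern_def)
      have "i + k = ?c" using gal[of "i + k"] gal[of "Suc (i + k)"] k i by simp
      moreover have "part mu (i + k) \<le> part mu i" using part_antimono[OF mu i] by simp
      ultimately show "(i, j) \<in> initial_broken_diagonals lam mu r"
        using True k i cd by (auto simp: initial_broken_diagonals_def shifted_diagram_def content_def)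
    next
      assume "(i, j) \<in> initial_broken_diagonals lam mu r"
      then have i: "1 \<le> i" "i \<le> ?d" "i \<le> j" "j < part mu i + ?d"
          and j: "j + ?c + 1 = i + r + ?d"
        using True cd by (auto simp: initial_broken_diagonals_def shifted_diagram_def content_def)
      have "i \<le> ?c" using gal[OF i(1)] i j by linarith
      then obtain k where k: "?c = i + k" using le_Suc_ex by blast
      then show "(i, j) \<in> pattern_diagonals ?d (lowest_pattern mu) r"
        using gal[of "i + k"] gal[of "Suc (i + k)"] i j
        by (auto simp: pattern_diagonals_def lowest_pattern_def intro!: exI[of _ k])
    qed
    then show ?thesis by auto
  qed
qed

text \<open>
  Take \<open>\<nu> (a + 1) k > \<nu> a (k + 1)\<close> with \<open>a\<close> as large as possible, so that row \<open>a + 2\<close> is row \<open>a + 1\<close> shifted.  Then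
  \<open>\<nu> (a + 2) k = \<nu> (a + 1) (k + 1) \<le> \<nu> a (k + 1) < \<nu> (a + 1) k\<close>, and both lower bounds leave room to decrement.
\<close>

lemma decrement_exists:
  assumes \<nu>: "\<nu> \<in> patterns lam (\<lambda>k. part mu (Suc k))" and "\<nu> \<noteq> lowest_pattern mu"
  obtains \<nu>' a k where "\<nu>' \<in> patterns lam (\<lambda>k. part mu (Suc k))" "\<nu> = increment \<nu>' (Suc a) k"
    "Suc a + k < length lam"
proof -
  let ?A = "{a. \<exists>k. \<nu> (Suc a) k \<noteq> \<nu> a (Suc k)}"
  have "?A \<noteq> {}"
  proof
    assume "?A = {}"
    then have step: "\<nu> (Suc a) k = \<nu> a (Suc k)" for a k by blast
    have "\<nu> a k = lowest_pattern mu a k" for a k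
      by (induction a arbitrary: k) (auto simp: patternsD(1)[OF \<nu>] step lowest_pattern_def)
    then show False using assms(2) by blast
  qed
  moreover have fin: "finite ?A"
  proof (rule finite_subset)
    have "\<nu> (Suc a) k = 0 \<and> \<nu> a (Suc k) = 0" if "length lam \<le> a" for a k
      using that patterns_eq_0[OF \<nu>] by simp
    then show "?A \<subseteq> {..<length lam}" by (auto simp: not_le[symmetric])
  qed simp
  ultimately have "Max ?A \<in> ?A" by (intro Max_in)
  moreover define a where "a = Max ?A"
  ultimately obtain k where "\<nu> (Suc a) k \<noteq> \<nu> a (Suc k)" by blast
  then have lt: "\<nu> a (Suc k) < \<nu> (Suc a) k" using patternsD(2)[OF \<nu>, of a k] by simp
  have "Suc a \<notin> ?A" using Max_ge[OF fin, of "Suc a"] unfolding a_def by auto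
  then have "\<nu> (Suc (Suc a)) k = \<nu> (Suc a) (Suc k)" by blast
  then have lt': "\<nu> (Suc (Suc a)) k < \<nu> (Suc a) k"
    using lt patternsD(3)[OF \<nu>, of a "Suc k"] by simp
  define \<nu>' where "\<nu>' = \<nu>(Suc a := (\<nu> (Suc a))(k := \<nu> (Suc a) k - 1))"
  have app: "\<nu>' b l = (if b = Suc a \<and> l = k then \<nu> (Suc a) k - 1 else \<nu> b l)" for b l
    by (simp add: \<nu>'_def)
  have "\<nu>' \<in> patterns lam (\<lambda>k. part mu (Suc k))"
  proof (rule patternsI)
    show "\<nu>' 0 = (\<lambda>k. part mu (Suc k))" using patternsD(1)[OF \<nu>] by (simp add: \<nu>'_def)
    fix b l
    show "\<nu>' b (Suc l) \<le> \<nu>' (Suc b) l"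
      using patternsD(2)[OF \<nu>, of b l] lt by (auto simp: app)
    show "\<nu>' (Suc b) l \<le> \<nu>' b l"
      using patternsD(3)[OF \<nu>, of b l] lt' by (auto simp: app)
    show "\<nu>' b l \<le> part lam (Suc b) + l"
      using patternsD(4)[OF \<nu>, of b l] by (auto simp: app)
  qed
  moreover have "\<nu> = increment \<nu>' (Suc a) k"
    using lt by (auto simp: fun_eq_iff increment_apply app)
  moreover have "Suc a + k < length lam"
    by (rule ccontr) (use patterns_eq_0[OF \<nu>, of "Suc a" k] lt in simp)
  ultimately show ?thesis by (rule that)
qed

text \<open>
  Decrementing repeatedly leads down to the lowest pattern; read backwards, this is a sequence of moves.
\<close>

lemma broken_diagonals_rel_patterns:
  assumes lam: "is_partition lam" and mu: "is_partition mu" and sub: "diagram mu \<subseteq> diagram lam"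
    and "\<nu> \<in> patterns lam (\<lambda>k. part mu (Suc k))"
  shows "broken_diagonals_rel lam mu (pattern_diagram lam \<nu>) (pattern_diagonals (length lam) \<nu>)"
  using assms(4)
proof (induction "\<Sum>a<length lam. \<Sum>k<length lam. \<nu> a k" arbitrary: \<nu> rule: less_induct)
  case less
  let ?d = "length lam"
  show ?case
  proof (cases "\<nu> = lowest_pattern mu")
    case True
    then show ?thesis
      using broken_diagonals_rel.start[of lam mu]
      by (simp add: pattern_diagram_lowest[OF mu] pattern_diagonals_lowest[OF mu sub])
  next
    case False
    then obtain \<nu>' a k where \<nu>': "\<nu>' \<in> patterns lam (\<lambda>k. part mu (Suc k))"
      and \<nu>: "\<nu> = increment \<nu>' (Suc a) k" and ak: "Suc a + k < ?d"
      by (rule decrement_exists[OF less.prems])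
    have mono: "(\<Sum>k<?d. \<nu>' b k) \<le> (\<Sum>k<?d. \<nu> b k)" for b
      by (intro sum_mono) (simp add: \<nu> increment_apply)
    moreover have "(\<Sum>k<?d. \<nu>' (Suc a) k) < (\<Sum>k<?d. \<nu> (Suc a) k)"
      using ak by (intro sum_strict_mono_ex1) (auto simp: \<nu> increment_apply intro!: bexI[of _ k])
    ultimately have "(\<Sum>b<?d. \<Sum>k<?d. \<nu>' b k) < (\<Sum>b<?d. \<Sum>k<?d. \<nu> b k)"
      using ak by (intro sum_strict_mono_ex1) (auto intro!: bexI[of _ "Suc a"])
    from less.hyps[OF this \<nu>']
    have IH: "broken_diagonals_rel lam mu (pattern_diagram lam \<nu>') (pattern_diagonals ?d \<nu>')" .
    define j where "j = ?d + \<nu>' (Suc a) k - k"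
    have j: "j + k = ?d + \<nu>' (Suc a) k" using ak by (simp add: j_def)
    note inc = increment_is_move[OF lam \<nu>' less.prems[unfolded \<nu>] j]
    show ?thesis
      using broken_diagonals_rel.move[OF IH inc(1), of "Suc (\<nu>' (Suc a) k)"] inc(2,3)
        pattern_diagonals_increment[OF \<nu>' less.prems[unfolded \<nu>] j]
      unfolding \<nu> by simp
  qed
qed

lemma broken_diagonals_relD:
  assumes lam: "is_partition lam" and mu: "is_partition mu" and sub: "diagram mu \<subseteq> diagram lam"
    and "broken_diagonals_rel lam mu D b"
  shows "\<exists>\<nu>\<in>patterns lam (\<lambda>k. part mu (Suc k)).
    D = pattern_diagram lam \<nu> \<and> b = pattern_diagonals (length lam) \<nu>"
  using assms(4)
proof induction
  case start
  then show ?case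
    using lowest_pattern_in_patterns[OF mu sub] pattern_diagram_lowest[OF mu, of lam]
      pattern_diagonals_lowest[OF mu sub] by metis
next
  case (move D b i j D' t)
  then obtain \<nu> where \<nu>: "\<nu> \<in> patterns lam (\<lambda>k. part mu (Suc k))"
    and D: "D = pattern_diagram lam \<nu>" and b: "b = pattern_diagonals (length lam) \<nu>" by blast
  obtain a k where i: "i = Suc (Suc a)" and j: "j + k = length lam + \<nu> (Suc a) k"
    and \<nu>': "increment \<nu> (Suc a) k \<in> patterns lam (\<lambda>k. part mu (Suc k))"
    using move_is_increment[OF lam \<nu>] move.hyps(2) D by metis
  note inc = increment_is_move[OF lam \<nu> \<nu>' j]
  have "D' = pattern_diagram lam (increment \<nu> (Suc a) k)"
    using inc(1) move.hyps(2) unfolding D i by (simp add: reverse_excited_move_def)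
  moreover have "t = Suc (\<nu> (Suc a) k)"
    using pattern_diagonals_disjoint[OF \<nu> _ inc(2), of t] move.hyps(4) by (simp add: b i)
  ultimately show ?case
    using \<nu>' pattern_diagonals_increment[OF \<nu> \<nu>' j] by (auto simp: b i)
qed

lemma reverse_excited_diagrams_eq:
  assumes lam: "is_partition lam" and mu: "is_partition mu" and sub: "diagram mu \<subseteq> diagram lam"
  shows "reverse_excited_diagrams lam mu = pattern_diagram lam ` patterns lam (\<lambda>k. part mu (Suc k))"
proof (intro equalityI subsetI)
  fix D assume "D \<in> reverse_excited_diagrams lam mu"
  then show "D \<in> pattern_diagram lam ` patterns lam (\<lambda>k. part mu (Suc k))"
  proof induction
    case start
    then show ?case
      using lowest_pattern_in_patterns[OF mu sub] pattern_diagram_lowest[OF mu, of lam] by blast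
  next
    case (move D i j D')
    then obtain \<nu> where \<nu>: "\<nu> \<in> patterns lam (\<lambda>k. part mu (Suc k))"
      and D: "D = pattern_diagram lam \<nu>" by blast
    obtain a k where i: "i = Suc (Suc a)" and j: "j + k = length lam + \<nu> (Suc a) k"
      and \<nu>': "increment \<nu> (Suc a) k \<in> patterns lam (\<lambda>k. part mu (Suc k))"
      using move_is_increment[OF lam \<nu>] move.hyps(2) D by metis
    have "D' = pattern_diagram lam (increment \<nu> (Suc a) k)"
      using increment_is_move(1)[OF lam \<nu> \<nu>' j] move.hyps(2) unfolding D i
      by (simp add: reverse_excited_move_def)
    then show ?case using \<nu>' by blast
  qed
next
  have "D \<in> reverse_excited_diagrams lam mu" if "broken_diagonals_rel lam mu D b" for D b
    using that by induction (auto intro: reverse_excited_diagrams.intros)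
  then show "D \<in> reverse_excited_diagrams lam mu"
    if "D \<in> pattern_diagram lam ` patterns lam (\<lambda>k. part mu (Suc k))" for D
    using that broken_diagonals_rel_patterns[OF lam mu sub] by blast
qed

lemma broken_diagonals_eq:
  assumes lam: "is_partition lam" and mu: "is_partition mu" and sub: "diagram mu \<subseteq> diagram lam"
    and \<nu>: "\<nu> \<in> patterns lam (\<lambda>k. part mu (Suc k))"
  shows "broken_diagonals lam mu (pattern_diagram lam \<nu>) = pattern_diagonals (length lam) \<nu>"
  unfolding broken_diagonals_def
proof (rule the_equality)
  fix b assume "broken_diagonals_rel lam mu (pattern_diagram lam \<nu>) b"
  then obtain \<nu>' where "\<nu>' \<in> patterns lam (\<lambda>k. part mu (Suc k))"
      "pattern_diagram lam \<nu> = pattern_diagram lam \<nu>'" "b = pattern_diagonals (length lam) \<nu>'"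
    using broken_diagonals_relD[OF lam mu sub] by blast
  then show "b = pattern_diagonals (length lam) \<nu>"
    using \<nu> inj_onD[OF pattern_diagram_inj] by metis
qed (rule broken_diagonals_rel_patterns[OF lam mu sub \<nu>])

text \<open>
  The arm length at the cell of the broken diagonals coming from \<open>(k + 1, r)\<close> with entry \<open>a + 1\<close> is \<open>\<lambda>\<^bsub>a+1\<^esub> + k + 1 - r\<close>, the factor of
  that cell in the weight of the pattern.  Distinct cells of the tableau give distinct cells because the
  intervals are disjoint.
\<close>

lemma prod_pattern_diagonals:
  assumes \<nu>: "\<nu> \<in> patterns lam m"
  shows "(\<Prod>(i, j)\<in>(\<Union>r\<in>{1..m 0}. pattern_diagonals (length lam) \<nu> r).
      real (part lam i) + real (length lam) - real j) = pattern_weight lam \<nu>"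
proof -
  let ?d = "length lam"
  let ?I = "SIGMA a:{..<?d}. SIGMA k:{..<?d - a}. {\<nu> (Suc a) k<..\<nu> a k}"
  let ?f = "\<lambda>(a, k, r). (Suc a, ?d + r - k - 1)"
  have cov: "j + k + 1 = ?d + r \<and> covers ?d \<nu> a j k"
    if "(a, k, r) \<in> ?I" "j = ?d + r - k - 1" for a k r j
    using that by (auto simp: covers_def)
  have inj: "inj_on ?f ?I"
  proof (rule inj_onI)
    fix x y assume xy: "x \<in> ?I" "y \<in> ?I" "?f x = ?f y"
    obtain a k r b l s where x: "x = (a, k, r)" and y: "y = (b, l, s)" by (metis prod_cases3)
    have "b = a" using xy(3) x y by simp
    moreover define j where "j = ?d + r - k - 1"
    moreover have "j = ?d + s - l - 1" using xy(3) x y j_def by simp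
    ultimately have "j + k + 1 = ?d + r" "j + l + 1 = ?d + s" "covers ?d \<nu> a j k" "covers ?d \<nu> a j l"
      using cov[of a k r j] cov[of b l s j] xy(1,2) x y by auto
    then show "x = y" using covers_unique[OF \<nu>, of ?d a j k l] x y \<open>b = a\<close> by simp
  qed
  have img: "(\<Union>r\<in>{1..m 0}. pattern_diagonals ?d \<nu> r) = ?f ` ?I"
  proof (intro equalityI subsetI)
    fix u assume "u \<in> (\<Union>r\<in>{1..m 0}. pattern_diagonals ?d \<nu> r)"
    then obtain i j k r where u: "u = (i, j)" "1 \<le> i" "j + k + 1 = ?d + r" "\<nu> i k < r" "r \<le> \<nu> (i - 1) k"
      by (auto simp: pattern_diagonals_def)
    have "i - 1 + k < ?d"
      by (rule ccontr) (use patterns_eq_0[OF \<nu>, of "i - 1" k] u in simp)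
    then have "(i - 1, k, r) \<in> ?I" using u by auto
    moreover have "u = ?f (i - 1, k, r)" using u by auto
    ultimately show "u \<in> ?f ` ?I" by blast
  next
    fix u assume "u \<in> ?f ` ?I"
    then obtain a k r where u: "u = (Suc a, ?d + r - k - 1)" "(a, k, r) \<in> ?I" by auto
    then have "u \<in> pattern_diagonals ?d \<nu> r"
      by (auto simp: pattern_diagonals_def intro!: exI[of _ k])
    moreover have "r \<in> {1..m 0}" using u(2) patterns_le_first[OF \<nu>, of a k] by auto
    ultimately show "u \<in> (\<Union>r\<in>{1..m 0}. pattern_diagonals ?d \<nu> r)" by blast
  qed
  have "pattern_weight lam \<nu> = (\<Prod>(a, k, r)\<in>?I. real (lam ! a) + real k + 1 - real r)"
    unfolding pattern_weight_def strip_weight_def by (simp add: prod.Sigma)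
  also have "\<dots> = (\<Prod>x\<in>?I. case ?f x of (i, j) \<Rightarrow> real (part lam i) + real ?d - real j)"
    by (intro prod.cong refl) (auto simp: part_def of_nat_diff)
  finally show ?thesis unfolding img prod.reindex[OF inj] by simp
qed

theorem mainTheorem4:
  fixes lam mu :: "nat list"
  assumes "is_partition lam" and "is_partition mu"
    and "diagram mu \<subseteq> diagram lam"
  shows "real (num_SYT lam mu) =
    fact (card (skew_diagram lam mu)) / (\<Prod>u\<in>diagram lam. real_of_int (hook lam u)) *
    (\<Sum>D\<in>reverse_excited_diagrams lam mu.
       \<Prod>(i, j)\<in>broken_cells lam mu D. real (part lam i) + real (length lam) - real j)"
proof -
  let ?m = "\<lambda>k. part mu (Suc k)" and ?H = "\<Prod>u\<in>diagram lam. real_of_int (hook lam u)"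
  have skew: "skew_diagram lam mu = skew_cells lam ?m"
    by (auto simp: skew_diagram_def skew_cells_def diagram_def part_def split: if_splits)
  have "hook lam u \<noteq> 0" if u: "u \<in> diagram lam" for u
  proof -
    obtain i j where ij: "u = (i, j)" "1 \<le> i" "1 \<le> j" "j \<le> part lam i"
      using u by (auto simp: diagram_def)
    then have "i \<le> conj_part lam j" using conj_part_galois[OF assms(1)] by simp
    then show ?thesis using ij by (simp add: hook_def)
  qed
  moreover have "finite (diagram lam)"
  proof -
    have "diagram lam = skew_cells lam (\<lambda>_. 0)" by (auto simp: skew_cells_def diagram_def)
    then show ?thesis by (simp add: finite_skew_cells)
  qed
  ultimately have H: "?H \<noteq> 0" by simp
  have "(\<Sum>D\<in>reverse_excited_diagrams lam mu.
       \<Prod>(i, j)\<in>broken_cells lam mu D. real (part lam i) + real (length lam) - real j)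
    = (\<Sum>\<nu>\<in>patterns lam ?m. \<Prod>(i, j)\<in>broken_cells lam mu (pattern_diagram lam \<nu>).
        real (part lam i) + real (length lam) - real j)"
    unfolding reverse_excited_diagrams_eq[OF assms] by (simp add: sum.reindex[OF pattern_diagram_inj])
  also have "\<dots> = (\<Sum>\<nu>\<in>patterns lam ?m. pattern_weight lam \<nu>)"
  proof (rule sum.cong[OF refl])
    fix \<nu> assume \<nu>: "\<nu> \<in> patterns lam ?m"
    show "(\<Prod>(i, j)\<in>broken_cells lam mu (pattern_diagram lam \<nu>).
        real (part lam i) + real (length lam) - real j) = pattern_weight lam \<nu>"
      using prod_pattern_diagonals[OF \<nu>] by (simp add: broken_cells_def broken_diagonals_eq[OF assms \<nu>])
  qed
  also have "\<dots> = shifted_schur lam ?m" by (rule shifted_schur_eq_sum_patterns[OF assms(1), symmetric])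
  finally have S: "(\<Sum>D\<in>reverse_excited_diagrams lam mu.
       \<Prod>(i, j)\<in>broken_cells lam mu D. real (part lam i) + real (length lam) - real j) = shifted_schur lam ?m" .
  have "antimono ?m" using part_antimono[OF assms(2)] by (simp add: decseq_Suc_iff)
  then have "real (num_SYT lam mu) * ?H = fact (card (skew_diagram lam mu)) * shifted_schur lam ?m"
    unfolding num_SYT_def skew
    using part_mono_diagram[OF assms(3)] by (intro card_standard_tableaux_shifted_schur[OF assms(1)]) auto
  then show ?thesis unfolding S using H by (simp add: field_simps)
qed

end
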